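(* Assume that $K$ is a p.c.f. self-similar set. Let $0<\alpha<s$ and $\frac{\alpha}{s}<p<\infty$. Then, for any $f\in L^p(K,H^\alpha_\mu)$, $$\int_K [M_{\mathcal{D}}^\mu f(x)]^p\, dH^\alpha_\mu\le C_{p,\alpha,s}\int_K |f(x)|^p\, dH^\alpha_\mu,$$ where $$C_{p,\alpha,s}:=\begin{cases}\dfrac{2^{p+2}}{p-\alpha/s} & \text{when } \alpha/s<p<1,\\[2mm] \dfrac{2^{2p+1}}{p(1-\alpha/s)} & \text{when } 1\le p<\infty.\end{cases}$$
   Context: Self-similar set and measure. For $1\le i\le m$ let $S_i:\mathbb{R}^d\to\mathbb{R}^d$, $S_i(x)=r_iR_i(x)+b_i$ with $0<r_i<1$, $b_i\in\mathbb{R}^d$, $R_i$ orthogonal. $K\subset\mathbb{R}^d$ is the unique nonempty compact set with $K=\bigcup_{i=1}^m S_i(K)$ (the self-similar set generated by $\{S_i\}_{i=1}^m$). It is always assumed that the $S_i$ do not all share a common fixed point. Given a probability vector $(p_1,\dots,p_m)$ with all $p_i>0$ and $\sum_i p_i=1$, $\mu$ is the unique Borel probability measure with $\mu=\sum_{i=1}^m p_i\,\mu\circ S_i^{-1}$ (self-similar measure; it is supported on $K$). $s$ denotes the Hausdorff dimension of $K$. Basic cubes. $\Sigma_n=\{1,\dots,m\}^n$ for $n\ge1$, $\Sigma_0=\{\emptyset\}$ (empty word). For $\mathbf{i}=i_1\ldots i_n$, $S_{\mathbf{i}}=S_{i_1}\circ\cdots\circ S_{i_n}$ and $K_{\mathbf{i}}=S_{\mathbf{i}}(K)$;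 $K_\emptyset=K$. $\mathcal{D}=\bigcup_{n\ge0}\{K_{\mathbf{i}}:\mathbf{i}\in\Sigma_n\}$ is the collection of basic cubes. P.c.f. Let $\Sigma_\infty=\{1,\dots,m\}^{\mathbb{N}}$, let $\Pi:\Sigma_\infty\to K$ be the coding map, $\{\Pi(\mathbf{i})\}=\bigcap_{n\ge1}K_{i_1\ldots i_n}$, and let $\sigma$ be the shift $\sigma(i_1,i_2,\dots)=(i_2,i_3,\dots)$. Put $\mathcal{C}_K=\bigcup_{i\ne j}(S_i(K)\cap S_j(K))$ and $\mathcal{C}=\Pi^{-1}(\mathcal{C}_K)$. $K$ is post-critically finite (p.c.f.) if $\bigcup_{n\ge1}\sigma^n(\mathcal{C})$ is a finite set. Hausdorff content. For $E\subset K$ and $0<\alpha\le s$, $H^\alpha_\mu(E)=\inf\{\sum_j\mu(I_j)^{\alpha/s}: E\subset\bigcup_jI_j,\ I_j\in\mathcal{D}\}$, over countable (possibly finite) covers. Choquet integral. For $\mu$-measurable $f\ge0$ on $K$, $\int_K f\,dH^\alpha_\mu=\int_0^\infty H^\alpha_\mu(\{x\in K:f(x)>t\})\,dt$. For $0<p<\infty$, $\|f\|^p_{L^p(K,H^\alpha_\mu)}=\int_K|f|^p\,dH^\alpha_\mu=p\int_0^\infty t^{p-1}H^\alpha_\mu(\{x\in K:|f(x)|>t\})\,dt$, and $L^p(K,H^\alpha_\mu)$ is the space of $\mu$-measurable functions $f$ on $K$ for which this is finite. Maximal operator. $M_{\mathcal{D}}^\mu f(x)=\sup\frac{1}{\mu(K_{\mathbf{i}})}\int_{K_{\mathbf{i}}}|f|\,d\mu$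 for $x\in K$, the supremum being over all $n\in\mathbb{N}=\{1,2,\dots\}$ and all $\mathbf{i}\in\Sigma_n$ with $x\in K_{\mathbf{i}}$. *)

theory Defs
  imports "HOL-Probability.Probability"
begin

section \<open>Hausdorff dimension\<close>

text \<open>Covers are sequences of bounded sets; finite covers are included by padding with the empty
  set, whose diameter is 0. Boundedness is required explicitly because the library's \<^const>\<open>diameter\<close>
  is only meaningful for bounded sets. Only exponents \<open>t > 0\<close> are used, so that \<open>0 powr t = 0\<close>
  has the intended value; restricting to \<open>t > 0\<close> does not change the infimum defining the
  dimension.\<close>

definition hausdorff_premeasure :: "real \<Rightarrow> real \<Rightarrow> 'a::metric_space set \<Rightarrow> ennreal" where
  "hausdorff_premeasure t \<delta> E =
     (INF U \<in> {U :: nat \<Rightarrow> 'a set. E \<subseteq> (\<Union>n. U n) \<and> (\<forall>n. bounded (U n) \<and> diameter (U n) \<le> \<delta>)}.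
        \<Sum>n. ennreal (diameter (U n) powr t))"

definition hausdorff_measure :: "real \<Rightarrow> 'a::metric_space set \<Rightarrow> ennreal" where
  "hausdorff_measure t E = (SUP \<delta> \<in> {0<..}. hausdorff_premeasure t \<delta> E)"

definition hausdorff_dim :: "'a::metric_space set \<Rightarrow> ennreal" where
  "hausdorff_dim E = (INF t \<in> {t. 0 < t \<and> hausdorff_measure t E = 0}. ennreal t)"

section \<open>Self-similar sets and measures\<close>

definition similarity_ifs ::
  "nat \<Rightarrow> (nat \<Rightarrow> real) \<Rightarrow> (nat \<Rightarrow> 'a \<Rightarrow> 'a) \<Rightarrow> (nat \<Rightarrow> 'a) \<Rightarrow> (nat \<Rightarrow> 'a \<Rightarrow> 'a::euclidean_space) \<Rightarrow> bool" where
  "similarity_ifs m r R b S \<longleftrightarrow>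
     (\<forall>i\<in>{1..m}. 0 < r i \<and> r i < 1 \<and> orthogonal_transformation (R i) \<and>
        (\<forall>x. S i x = r i *\<^sub>R R i x + b i)) \<and>
     (\<nexists>x. \<forall>i\<in>{1..m}. S i x = x)"

definition self_similar_set :: "nat \<Rightarrow> (nat \<Rightarrow> 'a \<Rightarrow> 'a::topological_space) \<Rightarrow> 'a set \<Rightarrow> bool" where
  "self_similar_set m S K \<longleftrightarrow> K \<noteq> {} \<and> compact K \<and> K = (\<Union>i\<in>{1..m}. S i ` K)"

definition probability_vector :: "nat \<Rightarrow> (nat \<Rightarrow> real) \<Rightarrow> bool" where
  "probability_vector m p \<longleftrightarrow> (\<forall>i\<in>{1..m}. 0 < p i) \<and> (\<Sum>i=1..m. p i) = 1"

definition self_similar_measure ::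
  "nat \<Rightarrow> (nat \<Rightarrow> 'a \<Rightarrow> 'a::topological_space) \<Rightarrow> (nat \<Rightarrow> real) \<Rightarrow> 'a measure \<Rightarrow> bool" where
  "self_similar_measure m S p \<mu> \<longleftrightarrow>
     prob_space \<mu> \<and> sets \<mu> = sets borel \<and>
     (\<forall>A \<in> sets borel. measure \<mu> A = (\<Sum>i=1..m. p i * measure \<mu> (S i -` A)))"

section \<open>Words, basic cubes and post-critical finiteness\<close>

definition words :: "nat \<Rightarrow> nat \<Rightarrow> nat list set" where
  "words m n = {w. length w = n \<and> set w \<subseteq> {1..m}}"

definition word_map :: "(nat \<Rightarrow> 'a \<Rightarrow> 'a) \<Rightarrow> nat list \<Rightarrow> 'a \<Rightarrow> 'a" where
  "word_map S w = foldr (\<lambda>i g. S i \<circ> g) w id"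

definition cube :: "(nat \<Rightarrow> 'a \<Rightarrow> 'a) \<Rightarrow> 'a set \<Rightarrow> nat list \<Rightarrow> 'a set" where
  "cube S K w = word_map S w ` K"

definition basic_cubes :: "nat \<Rightarrow> (nat \<Rightarrow> 'a \<Rightarrow> 'a) \<Rightarrow> 'a set \<Rightarrow> 'a set set" where
  "basic_cubes m S K = (\<Union>n. cube S K ` words m n)"

text \<open>Infinite words \<open>i\<^sub>1 i\<^sub>2 \<dots>\<close> are functions \<open>\<omega>\<close> on the naturals with \<open>i\<^sub>k = \<omega> (k - 1)\<close>.\<close>

definition infinite_words :: "nat \<Rightarrow> (nat \<Rightarrow> nat) set" where
  "infinite_words m = UNIV \<rightarrow> {1..m}"

definition coding_map :: "(nat \<Rightarrow> 'a \<Rightarrow> 'a) \<Rightarrow> 'a set \<Rightarrow> (nat \<Rightarrow> nat) \<Rightarrow> 'a" where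
  "coding_map S K \<omega> = (THE x. {x} = (\<Inter>n\<in>{1..}. cube S K (map \<omega> [0..<n])))"

definition left_shift :: "(nat \<Rightarrow> nat) \<Rightarrow> nat \<Rightarrow> nat" where
  "left_shift \<omega> = (\<lambda>k. \<omega> (Suc k))"

definition overlap_set :: "nat \<Rightarrow> (nat \<Rightarrow> 'a \<Rightarrow> 'a) \<Rightarrow> 'a set \<Rightarrow> 'a set" where
  "overlap_set m S K = (\<Union>i\<in>{1..m}. \<Union>j\<in>{1..m} - {i}. S i ` K \<inter> S j ` K)"

definition critical_set :: "nat \<Rightarrow> (nat \<Rightarrow> 'a \<Rightarrow> 'a) \<Rightarrow> 'a set \<Rightarrow> (nat \<Rightarrow> nat) set" where
  "critical_set m S K = {\<omega> \<in> infinite_words m. coding_map S K \<omega> \<in> overlap_set m S K}"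

definition pcf :: "nat \<Rightarrow> (nat \<Rightarrow> 'a \<Rightarrow> 'a) \<Rightarrow> 'a set \<Rightarrow> bool" where
  "pcf m S K \<longleftrightarrow> finite (\<Union>n\<in>{1..}. (left_shift ^^ n) ` critical_set m S K)"

section \<open>Hausdorff content and Choquet integral\<close>

text \<open>A countable, possibly finite, cover is a family \<open>I\<close> indexed by a set \<open>J\<close> of naturals.\<close>

definition hausdorff_content ::
  "nat \<Rightarrow> (nat \<Rightarrow> 'a \<Rightarrow> 'a) \<Rightarrow> 'a set \<Rightarrow> 'a measure \<Rightarrow> real \<Rightarrow> real \<Rightarrow> 'a set \<Rightarrow> ennreal" where
  "hausdorff_content m S K \<mu> s \<alpha> E =
     (INF (J, I) \<in> {(J :: nat set, I :: nat \<Rightarrow> 'a set).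
          (\<forall>j\<in>J. I j \<in> basic_cubes m S K) \<and> E \<subseteq> (\<Union>j\<in>J. I j)}.
        \<integral>\<^sup>+ j. ennreal (measure \<mu> (I j) powr (\<alpha> / s)) \<partial>count_space J)"

definition choquet_integral :: "('a set \<Rightarrow> ennreal) \<Rightarrow> 'a set \<Rightarrow> ('a \<Rightarrow> ennreal) \<Rightarrow> ennreal" where
  "choquet_integral H K g = (\<integral>\<^sup>+ t \<in> {0<..}. H {x \<in> K. g x > ennreal t} \<partial>lborel)"

text \<open>The power \<open>x\<^sup>p\<close> on \<open>[0, \<infinity>]\<close>, used for \<open>p > 0\<close> only.\<close>

definition ennreal_powr :: "ennreal \<Rightarrow> real \<Rightarrow> ennreal" where
  "ennreal_powr x p = (if x = \<infinity> then \<infinity> else ennreal (enn2real x powr p))"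

text \<open>Functions on \<open>K\<close> are total functions whose values outside \<open>K\<close> are irrelevant;
  \<open>\<mu>\<close>-measurable means measurable with respect to the completion of \<open>\<mu>\<close>.\<close>

definition mu_measurable_on :: "'a measure \<Rightarrow> 'a set \<Rightarrow> ('a \<Rightarrow> real) \<Rightarrow> bool" where
  "mu_measurable_on \<mu> K f \<longleftrightarrow> f \<in> borel_measurable (restrict_space (completion \<mu>) K)"

definition Lp_content ::
  "nat \<Rightarrow> (nat \<Rightarrow> 'a \<Rightarrow> 'a) \<Rightarrow> 'a set \<Rightarrow> 'a measure \<Rightarrow> real \<Rightarrow> real \<Rightarrow> real \<Rightarrow> ('a \<Rightarrow> real) set" where
  "Lp_content m S K \<mu> s \<alpha> p =
     {f. mu_measurable_on \<mu> K f \<and>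
         choquet_integral (hausdorff_content m S K \<mu> s \<alpha>) K (\<lambda>x. ennreal (\<bar>f x\<bar> powr p)) < \<infinity>}"

section \<open>Maximal operator\<close>

definition maximal_operator ::
  "nat \<Rightarrow> (nat \<Rightarrow> 'a \<Rightarrow> 'a) \<Rightarrow> 'a set \<Rightarrow> 'a measure \<Rightarrow> ('a \<Rightarrow> real) \<Rightarrow> 'a \<Rightarrow> ennreal" where
  "maximal_operator m S K \<mu> f x =
     (SUP w \<in> {w. \<exists>n\<ge>1. w \<in> words m n \<and> x \<in> cube S K w}.
        (\<integral>\<^sup>+ y \<in> cube S K w. ennreal \<bar>f y\<bar> \<partial>completion \<mu>) / emeasure \<mu> (cube S K w))"

definition maximal_const :: "real \<Rightarrow> real \<Rightarrow> real \<Rightarrow> real" where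
  "maximal_const p \<alpha> s =
     (if p < 1 then 2 powr (p + 2) / (p - \<alpha> / s)
      else 2 powr (2 * p + 1) / (p * (1 - \<alpha> / s)))"

end

theory Submission
  imports Defs
begin

text \<open>
Why the theorem is true. Write \<open>\<beta> = \<alpha> / s\<close>, and give a basic cube the weight \<open>\<mu>(Q)\<^sup>\<beta>\<close>.

Post-critical finiteness makes the overlaps of the first level cubes finite, so that all points that
belong to two cubes with incomparable words form a countable set. The measure has no atoms, because
the finitely many atoms of maximal mass would be permuted by the contractions and would collapse to
a common fixed point. Hence this countable set is null and, as every point lies in
cubes of arbitrarily small measure, it has content zero as well. Off this set the basic cubes are
nested or disjoint: they form a tree, exactly like dyadic cubes.

On a tree, the Choquet integral of a combination \<open>\<Sum> c\<^sub>w 1\<^bsub>Q w\<^esub>\<close> with nonnegative coefficients is at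
most \<open>\<Sum> c\<^sub>w \<mu>(Q w)\<^sup>\<beta>\<close> (\<open>choquet_integral_cube_combination_le\<close>): the superlevel set at height \<open>t\<close> is covered by the
cubes at which the partial sum along the branch first passes \<open>t\<close>, and a given cube \<open>Q w\<close> is used for a
set of heights of length at most \<open>c\<^sub>w\<close>. So it is enough to dominate \<open>(M f)\<^sup>p\<close> by a combination of
cubes.

For the indicator of one cube \<open>Q v\<close>, the mean over a cube \<open>Q w\<close> vanishes unless \<open>v\<close> and \<open>w\<close> are
comparable, and for a prefix \<open>w\<close> of \<open>v\<close> it is \<open>\<mu>(Q v) / \<mu>(Q w)\<close>. Thus the \<open>\<theta>\<close>-th power of its maximal
function is dominated by a combination of the cubes of the prefixes of \<open>v\<close>, whose weighted sum
compares with \<open>\<mu>(Q v)\<^sup>\<beta>\<close> times the integral of \<open>\<theta> t\<^bsup>\<theta>-1-\<beta>\<^esup>\<close> over \<open>[0,1]\<close>, which is \<open>\<theta> / (\<theta> - \<beta>)\<close>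
(\<open>average_indicator_powr_le\<close>, \<open>sum_average_increment_weight_le\<close>).

A general \<open>f\<close> is reduced to indicators by covering the sets where \<open>\<bar>f\<bar>\<^sup>p > 2\<^sup>k\<close> almost optimally
(\<open>dyadic_cover\<close>). If \<open>\<bar>f\<bar>\<^sup>p\<close> is at most the largest \<open>D\<^sub>j\<close> among the cubes \<open>Q\<^sub>j\<close> that contain the point,
then with \<open>\<theta> = min p 1\<close> Jensen's inequality and the subadditivity of the \<open>\<theta>\<close>-th power dominate
\<open>(M f)\<^sup>p\<close> by the sum of \<open>D\<^sub>j (M 1\<^bsub>Q j\<^esub>)\<^sup>\<theta>\<close> (\<open>maximal_operator_powr_le\<close>). Summing up gives the constant
\<open>4 \<theta> / (\<theta> - \<beta>)\<close>, which does not exceed the one claimed.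
\<close>

section \<open>Geometry of post-critically finite self-similar sets\<close>

lemma word_map_Nil [simp]: "word_map S [] = id"
  by (simp add: word_map_def)

lemma word_map_Cons [simp]: "word_map S (i # w) = S i \<circ> word_map S w"
  by (simp add: word_map_def)

lemma word_map_append: "word_map S (u @ v) = word_map S u \<circ> word_map S v"
  by (induction u) auto

lemma cube_append: "cube S K (u @ v) = word_map S u ` cube S K v"
  by (simp add: cube_def word_map_append image_comp)

lemma cube_Nil [simp]: "cube S K [] = K"
  by (simp add: cube_def)

text \<open>In this locale \<open>W\<close> is the set of all finite words over \<open>{1..m}\<close> and \<open>Q w\<close> the basic cube of the word
\<open>w\<close>. Prefixes of a word are written \<open>take k w\<close>, so that \<open>Q (take 0 w) = K\<close>.\<close>

locale pcf_self_similar =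
  fixes m :: nat
    and r :: "nat \<Rightarrow> real"
    and R S :: "nat \<Rightarrow> 'a \<Rightarrow> 'a::euclidean_space"
    and b :: "nat \<Rightarrow> 'a"
    and K :: "'a set"
    and q :: "nat \<Rightarrow> real"
    and \<mu> :: "'a measure"
  assumes ifs: "similarity_ifs m r R b S"
    and K: "self_similar_set m S K"
    and q: "probability_vector m q"
    and \<mu>: "self_similar_measure m S q \<mu>"
    and pcf: "pcf m S K"
begin

sublocale prob_space \<mu>
  using \<mu> by (simp add: self_similar_measure_def)

lemma sets_\<mu> [measurable_cong, simp]: "sets \<mu> = sets borel"
  using \<mu> by (simp add: self_similar_measure_def)

lemma space_\<mu> [simp]: "space \<mu> = UNIV"
  using sets_eq_imp_space_eq[OF sets_\<mu>] by simp

abbreviation W :: "nat list set" where "W \<equiv> {w. set w \<subseteq> {1..m}}"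

abbreviation Q :: "nat list \<Rightarrow> 'a set" where "Q \<equiv> cube S K"

lemma S_eq: "i \<in> {1..m} \<Longrightarrow> S i x = r i *\<^sub>R R i x + b i"
  using ifs by (simp add: similarity_ifs_def)

lemma r_bounds: "i \<in> {1..m} \<Longrightarrow> 0 < r i \<and> r i < 1"
  using ifs by (simp add: similarity_ifs_def)

lemma no_common_fixed_point: "\<exists>i\<in>{1..m}. S i x \<noteq> x"
  using ifs by (auto simp: similarity_ifs_def)

lemma dist_S:
  assumes "i \<in> {1..m}"
  shows "dist (S i x) (S i y) = r i * dist x y"
proof -
  have o: "orthogonal_transformation (R i)"
    using ifs assms by (simp add: similarity_ifs_def)
  have "S i x - S i y = r i *\<^sub>R (R i (x - y))"
    using linear_diff[OF orthogonal_transformation_linear[OF o], of x y] assms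
    by (simp add: S_eq scaleR_right_diff_distrib)
  then show ?thesis
    using orthogonal_transformation_norm[OF o] r_bounds[OF assms]
    by (simp add: dist_norm)
qed

lemma S_bij:
  assumes "i \<in> {1..m}"
  shows "bij (S i)"
proof -
  have "bij (R i)"
    using ifs assms by (simp add: similarity_ifs_def orthogonal_transformation_bij)
  moreover have "bij (\<lambda>x. r i *\<^sub>R x + b i)"
  proof (rule o_bij)
    show "(\<lambda>x. (1 / r i) *\<^sub>R (x - b i)) \<circ> (\<lambda>x. r i *\<^sub>R x + b i) = id"
      using r_bounds[OF assms] by auto
    show "(\<lambda>x. r i *\<^sub>R x + b i) \<circ> (\<lambda>x. (1 / r i) *\<^sub>R (x - b i)) = id"
      using r_bounds[OF assms] by auto
  qed
  ultimately have "bij ((\<lambda>x. r i *\<^sub>R x + b i) \<circ> R i)"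
    by (rule bij_comp)
  moreover have "(\<lambda>x. r i *\<^sub>R x + b i) \<circ> R i = S i"
    using assms by (auto simp: S_eq)
  ultimately show ?thesis by simp
qed

lemma inj_word_map: "w \<in> W \<Longrightarrow> inj (word_map S w)"
proof (induction w)
  case (Cons i w)
  then have "inj (S i)" "inj (word_map S w)"
    using bij_is_inj[OF S_bij[of i]] by auto
  then show ?case unfolding word_map_Cons by (rule inj_compose)
qed simp

lemma contraction_ratio:
  obtains \<rho> where "0 < \<rho>" "\<rho> < 1" "\<And>i. i \<in> {1..m} \<Longrightarrow> r i \<le> \<rho>"
proof
  let ?\<rho> = "Max (insert (1/2) (r ` {1..m}))"
  show "0 < ?\<rho>" by (subst Max_gr_iff) auto
  show "?\<rho> < 1" using r_bounds by (subst Max_less_iff) auto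
  show "r i \<le> ?\<rho>" if "i \<in> {1..m}" for i using that by (intro Max_ge) auto
qed

lemma dist_word_map:
  assumes "0 < \<rho>" "\<And>i. i \<in> {1..m} \<Longrightarrow> r i \<le> \<rho>" "w \<in> W"
  shows "dist (word_map S w x) (word_map S w y) \<le> \<rho> ^ length w * dist x y"
  using assms(3)
proof (induction w)
  case (Cons i w)
  then have i: "i \<in> {1..m}" and IH: "dist (word_map S w x) (word_map S w y) \<le> \<rho> ^ length w * dist x y"
    by auto
  have "r i * dist (word_map S w x) (word_map S w y) \<le> \<rho> * (\<rho> ^ length w * dist x y)"
    using assms(1) assms(2)[OF i] r_bounds[OF i] IH by (intro mult_mono) auto
  then show ?case using i by (simp add: dist_S mult.assoc)
qed simp

lemma compact_K: "compact K"
  using K by (simp add: self_similar_set_def)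

lemma K_eq: "K = (\<Union>i\<in>{1..m}. S i ` K)"
  using K unfolding self_similar_set_def by blast

lemma compact_cube:
  assumes "w \<in> W"
  shows "compact (Q w)"
proof -
  obtain \<rho> where \<rho>: "0 < \<rho>" "\<rho> < 1" "\<And>i. i \<in> {1..m} \<Longrightarrow> r i \<le> \<rho>"
    using contraction_ratio by blast
  have "(\<rho> ^ length w)-lipschitz_on UNIV (word_map S w)"
    using dist_word_map[OF \<rho>(1,3) assms] \<rho>(1) by (intro lipschitz_onI) auto
  then have "continuous_on K (word_map S w)"
    using lipschitz_on_continuous_on continuous_on_subset by blast
  then show ?thesis
    unfolding cube_def using compact_K by (rule compact_continuous_image)
qed

lemma cube_sets [measurable]: "w \<in> W \<Longrightarrow> Q w \<in> sets \<mu>"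
  unfolding sets_\<mu> by (intro borel_closed compact_imp_closed compact_cube)

lemma cube_subset_K: "w \<in> W \<Longrightarrow> Q w \<subseteq> K"
proof (induction w)
  case (Cons i w)
  then have "Q (i # w) \<subseteq> S i ` K" "i \<in> {1..m}"
    by (auto simp: cube_def)
  then show ?case using K_eq by blast
qed simp

lemma cube_append_subset: "v \<in> W \<Longrightarrow> Q (u @ v) \<subseteq> Q u"
  using image_mono[OF cube_subset_K] by (simp add: cube_append) (simp add: cube_def)

lemma cube_take_mono:
  assumes "w \<in> W" "j \<le> k"
  shows "Q (take k w) \<subseteq> Q (take j w)"
proof -
  have "take k w = take j w @ drop j (take k w)"
    using assms(2) by (metis append_take_drop_id min.absorb1 take_take)
  moreover have "drop j (take k w) \<in> W"
    using assms(1) set_drop_subset[of j "take k w"] set_take_subset[of k w] by blast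
  ultimately show ?thesis using cube_append_subset by metis
qed

lemma take_W: "w \<in> W \<Longrightarrow> take k w \<in> W"
  using set_take_subset[of k w] by auto

lemma cube_subset_take: "w \<in> W \<Longrightarrow> Q w \<subseteq> Q (take j w)"
  using cube_take_mono[of w j "max j (length w)"] by simp

text \<open>Since \<open>K\<close> is the union of the sets \<open>S i ` K\<close>, one can follow a point backwards forever, recording
the index at each step.\<close>

lemma coding_exists:
  assumes "x \<in> K"
  obtains \<omega> where "\<omega> \<in> infinite_words m" "\<And>n. x \<in> Q (map \<omega> [0..<n])"
proof -
  have "\<forall>x\<in>K. \<exists>i y. i \<in> {1..m} \<and> y \<in> K \<and> x = S i y"
    using K_eq by blast
  then obtain i y where iy: "\<And>x. x \<in> K \<Longrightarrow> i x \<in> {1..m} \<and> y x \<in> K \<and> x = S (i x) (y x)"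
    by metis
  define \<omega> where "\<omega> n = i ((y ^^ n) x)" for n
  have yK: "(y ^^ n) x \<in> K" for n
    using assms iy by (induction n) auto
  have "x = word_map S (map \<omega> [0..<n]) ((y ^^ n) x)" for n
  proof (induction n)
    case (Suc n)
    then show ?case using iy[OF yK[of n]]
      by (simp add: word_map_append \<omega>_def)
  qed simp
  then have "x \<in> Q (map \<omega> [0..<n])" for n
    using yK[of n] unfolding cube_def by blast
  moreover have "\<omega> \<in> infinite_words m"
    using iy[OF yK] by (auto simp: infinite_words_def \<omega>_def)
  ultimately show thesis using that by blast
qed

lemma prefix_W: "\<omega> \<in> infinite_words m \<Longrightarrow> map \<omega> [0..<n] \<in> W"
  by (force simp: infinite_words_def Pi_iff)

text \<open>The diameters of the cubes along a coding tend to zero geometrically.\<close>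

lemma Inter_cubes_of_coding:
  assumes \<omega>: "\<omega> \<in> infinite_words m" and x: "\<And>n. x \<in> Q (map \<omega> [0..<n])"
  shows "(\<Inter>n\<in>{1..}. Q (map \<omega> [0..<n])) = {x}"
proof -
  obtain \<rho> where \<rho>: "0 < \<rho>" "\<rho> < 1" "\<And>i. i \<in> {1..m} \<Longrightarrow> r i \<le> \<rho>"
    using contraction_ratio by blast
  have "y = x" if y: "\<And>n. n \<ge> 1 \<Longrightarrow> y \<in> Q (map \<omega> [0..<n])" for y
  proof -
    have le: "dist x y \<le> \<rho> ^ n * diameter K" if n: "n \<ge> 1" for n
    proof -
      let ?w = "map \<omega> [0..<n]"
      obtain x' y' where xy: "x' \<in> K" "y' \<in> K" "x = word_map S ?w x'" "y = word_map S ?w y'"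
        using x[of n] y[OF n] unfolding cube_def by blast
      have "dist x y \<le> \<rho> ^ n * dist x' y'"
        using dist_word_map[OF \<rho>(1,3) prefix_W[OF \<omega>], of n x' y'] xy by simp
      also have "\<dots> \<le> \<rho> ^ n * diameter K"
        using \<rho> diameter_bounded_bound[OF compact_imp_bounded[OF compact_K] xy(1,2)]
        by (intro mult_left_mono) auto
      finally show ?thesis .
    qed
    have "(\<lambda>n. \<rho> ^ n * diameter K) \<longlonglongrightarrow> 0 * diameter K"
      using \<rho> by (intro tendsto_mult LIMSEQ_realpow_zero tendsto_const) auto
    then have "dist x y \<le> 0"
      using le by (intro tendsto_lowerbound[where f="\<lambda>n. \<rho> ^ n * diameter K" and F=sequentially])
        (auto intro!: eventually_sequentiallyI[of 1])
    then show ?thesis by simp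
  qed
  then show ?thesis using x by auto
qed

lemma coding_map_eq:
  assumes "\<omega> \<in> infinite_words m" "\<And>n. x \<in> Q (map \<omega> [0..<n])"
  shows "coding_map S K \<omega> = x"
  unfolding coding_map_def Inter_cubes_of_coding[OF assms] by auto

text \<open>Post-critical finiteness speaks of the shifts of the critical words only, but a word is
determined by its shift and by its first letter, for which there are \<open>m\<close> choices.\<close>

lemma finite_critical_set: "finite (critical_set m S K)"
proof -
  let ?C = "critical_set m S K"
  have "left_shift ` ?C \<subseteq> (\<Union>n\<in>{1..}. (left_shift ^^ n) ` ?C)"
    using UN_upper[of 1 "{1..}" "\<lambda>n. (left_shift ^^ n) ` ?C"] by simp
  then have fin: "finite (left_shift ` ?C)"
    using pcf finite_subset unfolding pcf_def by blast
  have "?C \<subseteq> (\<lambda>(i, \<eta>). case_nat i \<eta>) ` ({1..m} \<times> left_shift ` ?C)"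
  proof
    fix \<omega> assume \<omega>: "\<omega> \<in> ?C"
    have "\<omega> = case_nat (\<omega> 0) (left_shift \<omega>)"
      by (auto simp: left_shift_def fun_eq_iff split: nat.split)
    moreover have "\<omega> 0 \<in> {1..m}"
      using \<omega> by (auto simp: critical_set_def infinite_words_def)
    ultimately show "\<omega> \<in> (\<lambda>(i, \<eta>). case_nat i \<eta>) ` ({1..m} \<times> left_shift ` ?C)"
      using \<omega> by (intro image_eqI[of _ _ "(\<omega> 0, left_shift \<omega>)"]) auto
  qed
  then show ?thesis
    using fin finite_subset by blast
qed

lemma finite_overlap_set: "finite (overlap_set m S K)"
proof -
  have "overlap_set m S K \<subseteq> coding_map S K ` critical_set m S K"
  proof
    fix x assume x: "x \<in> overlap_set m S K"
    then have "x \<in> K" using K_eq by (auto simp: overlap_set_def)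
    then obtain \<omega> where \<omega>: "\<omega> \<in> infinite_words m" "\<And>n. x \<in> Q (map \<omega> [0..<n])"
      using coding_exists by blast
    show "x \<in> coding_map S K ` critical_set m S K"
      using coding_map_eq[OF \<omega>] \<omega>(1) x by (intro image_eqI[of _ _ \<omega>]) (auto simp: critical_set_def)
  qed
  then show ?thesis
    using finite_critical_set finite_subset by blast
qed

text \<open>The points through which several branches of the tree of cubes can pass: two cubes whose words
split after the common prefix \<open>w\<close> meet inside the copy under \<open>word_map S w\<close> of the overlap set.\<close>

definition double_points :: "'a set" where
  "double_points = (\<Union>w\<in>W. word_map S w ` overlap_set m S K)"

lemma countable_double_points: "countable double_points"
  unfolding double_points_def
  by (intro countable_UN countable_image countable_finite[OF finite_overlap_set]) auto

text \<open>If the words \<open>u\<close> and \<open>w\<close> first differ at position \<open>k\<close>, then undoing the injective map of their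
common prefix moves \<open>x\<close> into \<open>S (u ! k) ` K \<inter> S (w ! k) ` K\<close>. This lemma is what replaces the
disjointness of half-open dyadic cubes of equal size.\<close>

lemma comparable_off_double_points:
  assumes "u \<in> W" "w \<in> W" "length u \<le> length w" "x \<in> Q u" "x \<in> Q w" "x \<notin> double_points"
  shows "u = take (length u) w"
proof (rule ccontr)
  assume neq: "u \<noteq> take (length u) w"
  define k where "k = (LEAST k. k < length u \<and> u ! k \<noteq> w ! k)"
  have "\<exists>k. k < length u \<and> u ! k \<noteq> w ! k"
    using neq assms(3) by (metis length_take min.absorb2 nth_equalityI nth_take)
  then have k: "k < length u" "u ! k \<noteq> w ! k"
    unfolding k_def using LeastI_ex[of "\<lambda>k. k < length u \<and> u ! k \<noteq> w ! k"] by blast+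
  have less: "u ! j = w ! j" if "j < k" for j
    using not_less_Least[OF that[unfolded k_def]] that k(1) by simp
  have tk: "take k u = take k w"
    using k(1) assms(3) less by (intro nth_equalityI) auto
  have split: "Q v = word_map S (take k v) ` S (v ! k) ` Q (drop (Suc k) v)" if "k < length v" for v
    using id_take_nth_drop[OF that] cube_append[of S K "take k v" "v ! k # drop (Suc k) v"]
    by (simp add: cube_def image_comp)
  have sub: "Q v \<subseteq> word_map S (take k v) ` S (v ! k) ` K" if "k < length v" "v \<in> W" for v
    unfolding split[OF that(1)]
    using that(2) set_drop_subset[of "Suc k" v] by (intro image_mono cube_subset_K) auto
  obtain y where y: "x = word_map S (take k u) y" "y \<in> S (u ! k) ` K"
    using sub[of u] assms k by blast
  obtain z where z: "x = word_map S (take k u) z" "z \<in> S (w ! k) ` K"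
    using sub[of w] assms k tk by (metis imageE less_le_trans subsetD)
  have "y = z"
    using y z inj_word_map[OF take_W[OF assms(1), of k]] by (simp add: inj_eq)
  moreover have "u ! k \<in> {1..m}" "w ! k \<in> {1..m}"
    using assms(1-3) k(1) nth_mem[of k u] nth_mem[of k w] by (auto simp del: nth_mem)
  ultimately have "y \<in> S (u ! k) ` K \<inter> S (w ! k) ` K" "u ! k \<in> {1..m}" "w ! k \<in> {1..m} - {u ! k}"
    using y(2) z(2) k(2) by auto
  then have "y \<in> overlap_set m S K"
    unfolding overlap_set_def by blast
  then have "x \<in> double_points"
    using y(1) take_W[OF assms(1), of k] unfolding double_points_def by blast
  then show False using assms by simp
qed

text \<open>The mass \<open>1\<close> has room for at most \<open>1 / c\<close> points of mass \<open>c\<close>.\<close>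

lemma finite_heavy_points:
  assumes "0 < c"
  shows "finite {x. c \<le> measure \<mu> {x}}"
proof -
  have "card F \<le> nat \<lfloor>1 / c\<rfloor>" if F: "F \<subseteq> {x. c \<le> measure \<mu> {x}}" "finite F" for F
  proof -
    have "real (card F) * c \<le> (\<Sum>x\<in>F. measure \<mu> {x})"
      using sum_mono[of F "\<lambda>_. c" "\<lambda>x. measure \<mu> {x}"] F(1) by auto
    also have "\<dots> = measure \<mu> (\<Union>x\<in>F. {x})"
      using F(2) by (intro finite_measure_finite_Union[symmetric]) (auto simp: disjoint_family_on_def)
    also have "\<dots> \<le> 1" by simp
    finally have "real (card F) \<le> 1 / c"
      using assms by (simp add: field_simps)
    then show ?thesis by linarith
  qed
  then show ?thesis by (rule finite_if_finite_subsets_card_bdd[THEN conjunct1, rule_format])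
qed

text \<open>If there were atoms, there would be finitely many of maximal mass. By self-similarity all
preimages of such an atom under the \<open>S i\<close> are again atoms of maximal mass, so every \<open>S i\<close> permutes
this finite set. A contraction can permute a finite set only if it is a single point, and that
point would be a common fixed point of the \<open>S i\<close>.\<close>

lemma no_atoms: "measure \<mu> {x} = 0"
proof (rule ccontr)
  assume "measure \<mu> {x} \<noteq> 0"
  then have x: "0 < measure \<mu> {x}"
    by (simp add: zero_less_measure_iff)
  define B where "B = {y. measure \<mu> {x} \<le> measure \<mu> {y}}"
  have B: "finite B" "x \<in> B"
    using finite_heavy_points[OF x] by (auto simp: B_def)
  define M where "M = Max ((\<lambda>y. measure \<mu> {y}) ` B)"
  have M_ge: "measure \<mu> {y} \<le> M" for y
  proof (cases "y \<in> B")
    case True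
    then show ?thesis unfolding M_def using B by (intro Max_ge) auto
  next
    case False
    then have "measure \<mu> {y} \<le> measure \<mu> {x}" by (simp add: B_def)
    also have "\<dots> \<le> M" unfolding M_def using B by (intro Max_ge) auto
    finally show ?thesis .
  qed
  have "M \<in> (\<lambda>y. measure \<mu> {y}) ` B"
    unfolding M_def using B by (intro Max_in) auto
  then obtain z where z: "measure \<mu> {z} = M" by auto
  define A where "A = {y. measure \<mu> {y} = M}"
  have "0 < M" using x M_ge[of x] by simp
  then have A: "finite A"
    using finite_subset[OF _ finite_heavy_points[of M], of A] by (auto simp: A_def)
  \<comment> \<open>A convex combination of numbers at most \<open>M\<close> equals \<open>M\<close> only if all of them do.\<close>
  have pre: "inv (S i) y \<in> A" if i: "i \<in> {1..m}" and y: "y \<in> A" for i y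
  proof (rule ccontr)
    assume "inv (S i) y \<notin> A"
    then have lt: "measure \<mu> {inv (S i) y} < M"
      using M_ge[of "inv (S i) y"] by (simp add: A_def)
    have vim: "S j -` {y} = {inv (S j) y}" if "j \<in> {1..m}" for j
      using S_bij[OF that] by (rule bij_vimage_eq_inv_image[of "S j" "{y}", simplified])
    have "M = measure \<mu> {y}" using y by (simp add: A_def)
    also have "\<dots> = (\<Sum>j=1..m. q j * measure \<mu> (S j -` {y}))"
      using \<mu> by (simp add: self_similar_measure_def)
    also have "\<dots> = (\<Sum>j=1..m. q j * measure \<mu> {inv (S j) y})"
      using vim by (intro sum.cong) auto
    also have "\<dots> < (\<Sum>j=1..m. q j * M)"
    proof (rule sum_strict_mono_ex1)
      show "\<forall>j\<in>{1..m}. q j * measure \<mu> {inv (S j) y} \<le> q j * M"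
        using q M_ge by (auto simp: probability_vector_def intro!: mult_left_mono less_imp_le)
      show "\<exists>j\<in>{1..m}. q j * measure \<mu> {inv (S j) y} < q j * M"
        using q lt i by (intro bexI[of _ i]) (auto simp: probability_vector_def)
    qed simp
    also have "\<dots> = M"
      using q by (simp add: probability_vector_def sum_distrib_right[symmetric])
    finally show False by simp
  qed
  have img: "S i ` A = A" if i: "i \<in> {1..m}" for i
  proof -
    have sub: "inv (S i) ` A \<subseteq> A" using pre[OF i] by auto
    have "inj_on (inv (S i)) A"
      using bij_imp_bij_inv[OF S_bij[OF i]] by (auto intro: inj_on_subset dest: bij_is_inj)
    then have "inv (S i) ` A = A"
      using endo_inj_surj[OF A sub] by simp
    then have "S i ` A = S i ` inv (S i) ` A" by simp
    also have "\<dots> = A"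
      using bij_is_surj[OF S_bij[OF i]] by (simp add: image_f_inv_f)
    finally show ?thesis .
  qed
  have zA: "z \<in> A" using z by (simp add: A_def)
  have "y = z" if i: "i \<in> {1..m}" and y: "y \<in> A" for i y
  proof (rule ccontr)
    assume "y \<noteq> z"
    \<comment> \<open>The contraction \<open>S i\<close> permutes \<open>A\<close>, so the largest distance inside \<open>A\<close> shrinks.\<close>
    define D where "D = Max ((\<lambda>(u, v). dist u v) ` (A \<times> A))"
    have fin: "finite ((\<lambda>(u, v). dist u v) ` (A \<times> A))" using A by simp
    have D_ge: "dist u v \<le> D" if "u \<in> A" "v \<in> A" for u v
      unfolding D_def by (rule Max_ge[OF fin]) (use that in auto)
    have "D \<in> (\<lambda>(u, v). dist u v) ` (A \<times> A)"
      unfolding D_def by (rule Max_in[OF fin]) (use zA in auto)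
    then obtain u v where uv: "u \<in> A" "v \<in> A" "D = dist u v" by auto
    obtain u' v' where uv': "u' \<in> A" "v' \<in> A" "u = S i u'" "v = S i v'"
      using uv img[OF i] by (metis imageE)
    have "D = r i * dist u' v'" using uv uv' dist_S[OF i] by simp
    also have "\<dots> \<le> r i * D"
      using D_ge[OF uv'(1,2)] r_bounds[OF i] by (intro mult_left_mono) auto
    finally have "D \<le> 0" using r_bounds[OF i] by (simp add: mult_le_cancel_right1 not_le)
    moreover have "0 < D" using D_ge[OF y zA] \<open>y \<noteq> z\<close> by (smt (verit) zero_less_dist_iff)
    ultimately show False by simp
  qed
  then have "S i z = z" if "i \<in> {1..m}" for i
    using img[OF that] zA that by blast
  then show False using no_common_fixed_point by blast
qed

lemma double_points_null: "double_points \<in> null_sets \<mu>"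
proof -
  have "(\<Union>x\<in>double_points. {x}) \<in> null_sets \<mu>"
    using no_atoms countable_double_points
    by (intro null_sets_UN') (auto simp: null_sets_def emeasure_eq_measure)
  then show ?thesis by simp
qed

text \<open>Along a coding of \<open>x\<close> the cubes decrease to \<open>{x}\<close>, which has measure zero.\<close>

lemma small_cube:
  assumes "x \<in> K" "0 < e"
  obtains w where "w \<in> W" "x \<in> Q w" "measure \<mu> (Q w) < e"
proof -
  obtain \<omega> where \<omega>: "\<omega> \<in> infinite_words m" "\<And>n. x \<in> Q (map \<omega> [0..<n])"
    using coding_exists[OF assms(1)] by blast
  let ?A = "\<lambda>n. Q (map \<omega> [0..<Suc n])"
  have "decseq ?A"
  proof (rule decseq_SucI)
    show "?A (Suc n) \<subseteq> ?A n" for n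
      using cube_append_subset[of "[\<omega> (Suc n)]" "map \<omega> [0..<Suc n]"] \<omega>(1)
      by (auto simp: infinite_words_def Pi_iff)
  qed
  moreover have "range ?A \<subseteq> sets \<mu>"
    using cube_sets[OF prefix_W[OF \<omega>(1)]] by blast
  ultimately have lim: "(\<lambda>n. measure \<mu> (?A n)) \<longlonglongrightarrow> measure \<mu> (\<Inter>n. ?A n)"
    by (intro finite_Lim_measure_decseq)
  have "(\<Inter>n. ?A n) = (\<Inter>n\<in>{1..}. Q (map \<omega> [0..<n]))"
    by (metis atLeast_Suc_greaterThan One_nat_def greaterThan_0 image_image)
  then have "(\<lambda>n. measure \<mu> (?A n)) \<longlonglongrightarrow> 0"
    using lim Inter_cubes_of_coding[OF \<omega>] no_atoms by simp
  then obtain n where "measure \<mu> (?A n) < e"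
    using eventually_happens[OF order_tendstoD(2)[OF _ assms(2)]] by (metis trivial_limit_sequentially)
  then show thesis using that \<omega> prefix_W by blast
qed

end

section \<open>Real and extended real inequalities\<close>

text \<open>This is the inequality \<open>\<theta> t powr (\<theta> - 1) y powr (- \<beta>) \<le> \<theta> t powr (\<theta> - \<beta> - 1)\<close>, integrated over \<open>t\<close>
from \<open>x\<close> to \<open>y\<close>. The proof uses Young's inequality for \<open>x powr \<theta>\<close> and \<open>y powr \<theta>\<close> instead. The right
side telescopes, which makes \<open>\<theta> / (\<theta> - \<beta>)\<close> the constant of the maximal inequality.\<close>

lemma powr_increment_bound:
  fixes x y \<beta> \<theta> :: real
  assumes "0 \<le> x" "x \<le> y" "0 < y" "0 < \<beta>" "\<beta> < \<theta>"
  shows "(y powr \<theta> - x powr \<theta>) * y powr (- \<beta>)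
    \<le> \<theta> / (\<theta> - \<beta>) * (y powr (\<theta> - \<beta>) - x powr (\<theta> - \<beta>))"
proof (cases "x = 0")
  case True
  have "y powr (\<theta> - \<beta>) \<le> \<theta> / (\<theta> - \<beta>) * y powr (\<theta> - \<beta>)"
    using assms by (simp add: divide_simps)
  then show ?thesis using True by (simp add: powr_add[symmetric])
next
  case False
  define \<gamma> where "\<gamma> = (\<theta> - \<beta>) / \<theta>"
  have \<gamma>: "0 < \<gamma>" "\<gamma> \<le> 1" using assms by (auto simp: \<gamma>_def)
  have x: "0 < x" using False assms by simp
  have "(x powr \<theta>) powr \<gamma> * (y powr \<theta>) powr (1 - \<gamma>) \<le> \<gamma> * x powr \<theta> + (1 - \<gamma>) * y powr \<theta>"
    using \<gamma> x assms by (intro Youngs_inequality_0) auto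
  moreover have "\<theta> * \<gamma> = \<theta> - \<beta>" "\<theta> * (1 - \<gamma>) = \<beta>"
    using assms by (auto simp: \<gamma>_def field_simps)
  ultimately have "x powr (\<theta> - \<beta>) * y powr \<beta> \<le> \<gamma> * x powr \<theta> + (1 - \<gamma>) * y powr \<theta>"
    by (simp add: powr_powr)
  then have "(x powr (\<theta> - \<beta>) * y powr \<beta>) * y powr (- \<beta>)
      \<le> (\<gamma> * x powr \<theta> + (1 - \<gamma>) * y powr \<theta>) * y powr (- \<beta>)"
    by (intro mult_right_mono) auto
  moreover have "y powr \<beta> * y powr (- \<beta>) = 1" "y powr \<theta> * y powr (- \<beta>) = y powr (\<theta> - \<beta>)"
    using assms(3) by (simp_all add: powr_add[symmetric])
  ultimately have "x powr (\<theta> - \<beta>) \<le> \<gamma> * x powr \<theta> * y powr (- \<beta>) + (1 - \<gamma>) * y powr (\<theta> - \<beta>)"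
    by (simp add: distrib_right mult.assoc)
  then have "\<gamma> * ((y powr \<theta> - x powr \<theta>) * y powr (- \<beta>)) \<le> y powr (\<theta> - \<beta>) - x powr (\<theta> - \<beta>)"
    using \<open>y powr \<theta> * y powr (- \<beta>) = y powr (\<theta> - \<beta>)\<close> by (simp add: algebra_simps)
  then have "(y powr \<theta> - x powr \<theta>) * y powr (- \<beta>) \<le> 1 / \<gamma> * (y powr (\<theta> - \<beta>) - x powr (\<theta> - \<beta>))"
    using \<gamma> by (simp add: field_simps)
  then show ?thesis by (simp add: \<gamma>_def)
qed

text \<open>The right side is the tangent at \<open>y powr P = a powr P\<close> of the concave function that sends \<open>y powr P\<close> to
\<open>y\<close>; averaging it gives Jensen's inequality with the mean compared to \<open>a\<close>.\<close>

lemma Youngs_inequality_powr: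
  fixes a y P :: real
  assumes "0 \<le> y" "0 < a" "1 \<le> P"
  shows "y \<le> a powr (1 - P) / P * y powr P + a * (1 - 1 / P)"
proof (cases "y = 0")
  case False
  then have y: "0 < y" using assms by simp
  have "(a powr (1 - P) * y powr P) powr (1 / P) * a powr (1 - 1 / P)
      \<le> 1 / P * (a powr (1 - P) * y powr P) + (1 - 1 / P) * a"
    using y assms by (intro Youngs_inequality_0) auto
  moreover have "(a powr (1 - P) * y powr P) powr (1 / P) * a powr (1 - 1 / P) = y"
  proof -
    have "(1 - P) / P + (1 - 1 / P) = 0" using assms by (simp add: field_simps)
    then have "a powr ((1 - P) / P) * a powr (1 - 1 / P) = 1"
      using assms by (simp add: powr_add[symmetric])
    then show ?thesis
      using y assms by (simp add: powr_mult powr_powr)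
  qed
  ultimately show ?thesis by (simp add: algebra_simps)
qed (use assms in simp)

text \<open>Jensen's inequality for a function that is dominated by a measurable one. Only the majorant \<open>h\<close> of
\<open>\<bar>f\<bar> powr P\<close> is integrated exactly; for \<open>f\<close> itself monotonicity of the integral is enough. Comparing
with a positive number \<open>a\<close> avoids powers of extended reals and the case of mean zero.\<close>

lemma average_le_of_average_powr_le:
  fixes f :: "'a \<Rightarrow> real"
  assumes A: "A \<in> sets M" and M: "0 < emeasure M A" "emeasure M A < \<infinity>"
    and a: "0 < a" "1 \<le> P"
    and h [measurable]: "h \<in> borel_measurable M"
    and fh: "\<And>y. y \<in> A \<Longrightarrow> ennreal (\<bar>f y\<bar> powr P) \<le> h y"
    and le: "(\<integral>\<^sup>+y\<in>A. h y \<partial>M) / emeasure M A \<le> ennreal (a powr P)"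
  shows "(\<integral>\<^sup>+y\<in>A. ennreal \<bar>f y\<bar> \<partial>M) / emeasure M A \<le> ennreal a"
proof -
  note A [measurable]
  obtain c where c: "emeasure M A = ennreal c" "0 < c"
    using M by (cases "emeasure M A") auto
  have le': "(\<integral>\<^sup>+y\<in>A. h y \<partial>M) \<le> ennreal (a powr P * c)"
  proof -
    have "(\<integral>\<^sup>+y\<in>A. h y \<partial>M) = (\<integral>\<^sup>+y\<in>A. h y \<partial>M) / emeasure M A * emeasure M A"
      using M by (simp add: ennreal_divide_times)
    also have "\<dots> \<le> ennreal (a powr P) * ennreal c"
      using le c by (intro mult_mono) auto
    finally show ?thesis using c by (simp add: ennreal_mult)
  qed
  have nn: "0 \<le> a powr (1 - P) / P" "0 \<le> a * (1 - 1 / P)"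
    using a by (auto simp: field_simps)
  have "(\<integral>\<^sup>+y\<in>A. ennreal \<bar>f y\<bar> \<partial>M)
      \<le> (\<integral>\<^sup>+y. ennreal (a powr (1 - P) / P) * (h y * indicator A y)
            + ennreal (a * (1 - 1 / P)) * indicator A y \<partial>M)"
  proof (rule nn_integral_mono)
    fix y
    have "ennreal \<bar>f y\<bar> \<le> ennreal (a powr (1 - P) / P * \<bar>f y\<bar> powr P + a * (1 - 1 / P))"
      using a by (intro ennreal_leI Youngs_inequality_powr) auto
    also have "\<dots> = ennreal (a powr (1 - P) / P) * ennreal (\<bar>f y\<bar> powr P) + ennreal (a * (1 - 1 / P))"
      by (simp only: ennreal_plus[OF mult_nonneg_nonneg[OF nn(1) powr_ge_zero] nn(2)]
          ennreal_mult[OF nn(1) powr_ge_zero])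
    finally have "ennreal \<bar>f y\<bar> \<le> ennreal (a powr (1 - P) / P) * h y + ennreal (a * (1 - 1 / P))"
      if "y \<in> A"
      using fh[OF that] by (meson add_right_mono mult_left_mono order_trans zero_le)
    then show "ennreal \<bar>f y\<bar> * indicator A y \<le> ennreal (a powr (1 - P) / P) * (h y * indicator A y)
            + ennreal (a * (1 - 1 / P)) * indicator A y"
      by (auto split: split_indicator)
  qed
  also have "\<dots> = ennreal (a powr (1 - P) / P) * (\<integral>\<^sup>+y\<in>A. h y \<partial>M) + ennreal (a * (1 - 1 / P)) * emeasure M A"
    by (simp add: nn_integral_add nn_integral_cmult)
  also have "\<dots> \<le> ennreal (a powr (1 - P) / P) * ennreal (a powr P * c) + ennreal (a * (1 - 1 / P)) * ennreal c"
    using le' c by (intro add_mono mult_left_mono) auto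
  also have "\<dots> = ennreal (a powr (1 - P) / P * (a powr P * c) + a * (1 - 1 / P) * c)"
  proof -
    have "0 \<le> a powr P * c" "0 \<le> c" using c by auto
    then show ?thesis
      using nn by (simp only: ennreal_plus ennreal_mult mult_nonneg_nonneg)
  qed
  also have "a powr (1 - P) / P * (a powr P * c) + a * (1 - 1 / P) * c = a * c"
  proof -
    have "a powr (1 - P) * a powr P = a"
      using a by (simp add: powr_add[symmetric])
    then have "a powr (1 - P) / P * (a powr P * c) = a * c / P"
      by (metis (no_types, lifting) mult.assoc times_divide_eq_left)
    then show ?thesis using a by (simp add: field_simps)
  qed
  finally show ?thesis
    using c a by (simp add: ennreal_mult divide_le_posI_ennreal ac_simps)
qed

text \<open>Each term is at most the total \<open>T\<close>, hence \<open>x j powr \<kappa> \<le> x j * T powr (\<kappa> - 1)\<close>. With \<open>\<kappa> = 1 / \<theta>\<close> this is the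
subadditivity of the power \<open>\<theta> \<le> 1\<close> over infinitely many terms.\<close>

lemma nn_integral_powr_le_powr_nn_integral:
  fixes x :: "'j \<Rightarrow> real"
  assumes x: "\<And>j. j \<in> J \<Longrightarrow> 0 \<le> x j" and \<kappa>: "1 \<le> \<kappa>" and T: "0 \<le> T"
    and le: "(\<integral>\<^sup>+j. ennreal (x j) \<partial>count_space J) \<le> ennreal T"
  shows "(\<integral>\<^sup>+j. ennreal (x j powr \<kappa>) \<partial>count_space J) \<le> ennreal (T powr \<kappa>)"
proof -
  have xT: "x j \<le> T" if j: "j \<in> J" for j
  proof -
    have "ennreal (x j) \<le> ennreal T"
      using nn_integral_ge_point[OF j, of "\<lambda>j. ennreal (x j)"] le by (rule order_trans)
    then show ?thesis using T by simp
  qed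
  have "(\<integral>\<^sup>+j. ennreal (x j powr \<kappa>) \<partial>count_space J) \<le> (\<integral>\<^sup>+j. ennreal (T powr (\<kappa> - 1)) * ennreal (x j) \<partial>count_space J)"
  proof (rule nn_integral_mono)
    fix j assume j: "j \<in> space (count_space J)"
    have "x j powr \<kappa> = x j powr (\<kappa> - 1) * x j"
      using x[of j] j by (cases "x j = 0") (auto simp: powr_diff)
    also have "\<dots> \<le> T powr (\<kappa> - 1) * x j"
      using x[of j] xT[of j] j \<kappa> by (intro mult_right_mono powr_mono2) auto
    finally show "ennreal (x j powr \<kappa>) \<le> ennreal (T powr (\<kappa> - 1)) * ennreal (x j)"
      using x[of j] j by (simp add: ennreal_mult[symmetric] ennreal_leI)
  qed
  also have "\<dots> \<le> ennreal (T powr (\<kappa> - 1)) * ennreal T"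
    using le by (subst nn_integral_cmult) (auto intro: mult_left_mono)
  also have "\<dots> = ennreal (T powr \<kappa>)"
    using T by (cases "T = 0") (auto simp: ennreal_mult[symmetric] powr_diff)
  finally show ?thesis .
qed

lemma emeasure_lborel_stopping_levels:
  fixes a c :: ennreal
  shows "emeasure lborel {t. 0 < t \<and> a \<le> ennreal t \<and> ennreal t < a + c} \<le> c"
proof (cases "a = \<infinity> \<or> c = \<infinity>")
  case True
  then show ?thesis by (auto simp: top_unique)
next
  case False
  then obtain a' c' where ac: "a = ennreal a'" "c = ennreal c'" "0 \<le> a'" "0 \<le> c'"
    by (metis ennreal_cases infinity_ennreal_def)
  have "{t. 0 < t \<and> a \<le> ennreal t \<and> ennreal t < a + c} \<subseteq> {a'..a'+c'}"
    using ac by (auto simp: ennreal_plus[symmetric] ennreal_less_iff simp del: ennreal_plus)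
  then have "emeasure lborel {t. 0 < t \<and> a \<le> ennreal t \<and> ennreal t < a + c} \<le> emeasure lborel {a'..a'+c'}"
    by (intro emeasure_mono) auto
  then show ?thesis using ac by simp
qed

lemma ennreal_powr_le:
  assumes "x \<le> ennreal (T powr (1 / p))" "0 \<le> T" "0 < p"
  shows "ennreal_powr x p \<le> ennreal T"
proof -
  have "x < \<infinity>" using assms(1) by (simp add: le_less_trans)
  then obtain y where y: "x = ennreal y" "0 \<le> y" by (cases x) auto
  have "y \<le> T powr (1 / p)" using assms y by simp
  then have "y powr p \<le> (T powr (1 / p)) powr p" using y assms by (intro powr_mono2) auto
  also have "\<dots> = T" using assms by (cases "T = 0") (auto simp: powr_powr)
  finally show ?thesis using y by (simp add: ennreal_powr_def ennreal_leI)
qed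

text \<open>The constant obtained below is \<open>4 \<theta> / (\<theta> - \<alpha> / s)\<close> with \<open>\<theta> = min p 1\<close>. For \<open>p < 1\<close> the comparison is
\<open>p \<le> 2 powr p\<close>, for \<open>p \<ge> 1\<close> it is \<open>p \<le> 2 powr (2 * p - 1)\<close>.\<close>

lemma maximal_const_ge:
  assumes "0 < \<alpha>" "\<alpha> < s" "\<alpha> / s < p"
  shows "4 * (min p 1 / (min p 1 - \<alpha> / s)) \<le> maximal_const p \<alpha> s"
proof (cases "p < 1")
  case True
  have p: "0 < p" using assms by (smt (verit) divide_pos_pos)
  have "p \<le> 2 powr p" using True p ge_one_powr_ge_zero[of 2 p] by linarith
  then have "4 * p \<le> 2 powr (p + 2)" by (simp add: powr_add)
  then show ?thesis using True assms
    by (simp add: maximal_const_def divide_right_mono)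
next
  case False
  have ln2: "1 / 2 \<le> ln (2::real)" using exp_half_le2 by (subst ln_ge_iff) auto
  have "p \<le> 1 + (2 * p - 1) * (1 / 2)" by (simp add: field_simps)
  also have "\<dots> \<le> 1 + (2 * p - 1) * ln 2" using ln2 False by (intro add_left_mono mult_left_mono) auto
  also have "\<dots> \<le> exp ((2 * p - 1) * ln 2)" by (rule exp_ge_add_one_self)
  also have "\<dots> = 2 powr (2 * p - 1)" by (simp add: powr_def)
  finally have "4 * p \<le> 2 powr (2 * p - 1) * 2 powr 2" by simp
  also have "\<dots> = 2 powr (2 * p + 1)" by (subst powr_add[symmetric]) (simp add: add.commute)
  finally have "4 \<le> 2 powr (2 * p + 1) / p" using False by (simp add: field_simps)
  moreover have "0 < 1 - \<alpha> / s" using assms by simp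
  ultimately have "4 / (1 - \<alpha> / s) \<le> 2 powr (2 * p + 1) / p / (1 - \<alpha> / s)"
    by (intro divide_right_mono) auto
  then show ?thesis using False by (simp add: maximal_const_def min_absorb2)
qed

section \<open>Hausdorff content of combinations of basic cubes\<close>

lemma nn_integral_count_space_mono_set:
  "A \<subseteq> B \<Longrightarrow> (\<integral>\<^sup>+x. g x \<partial>count_space A) \<le> (\<integral>\<^sup>+x. g x \<partial>count_space B)"
  by (auto simp: nn_integral_count_space_indicator split: split_indicator intro!: nn_integral_mono)

text \<open>A sum over an image does not count repetitions, a sum over the index set does.\<close>

lemma nn_integral_count_space_image_le:
  "(\<integral>\<^sup>+w. g w \<partial>count_space (v ` C)) \<le> (\<integral>\<^sup>+x. g (v x) \<partial>count_space C)"
proof -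
  have "bij_betw v (inv_into C v ` v ` C) (v ` C)"
    by (auto simp: bij_betw_def inj_on_def f_inv_into_f inv_into_into image_image cong: image_cong)
  then have "(\<integral>\<^sup>+w. g w \<partial>count_space (v ` C)) = (\<integral>\<^sup>+x. g (v x) \<partial>count_space (inv_into C v ` v ` C))"
    by (rule nn_integral_bij_count_space[symmetric])
  also have "\<dots> \<le> (\<integral>\<^sup>+x. g (v x) \<partial>count_space C)"
    by (rule nn_integral_count_space_mono_set) (auto simp: inv_into_into)
  finally show ?thesis .
qed

lemma choquet_integral_mono:
  assumes "\<And>A B. A \<subseteq> B \<Longrightarrow> B \<subseteq> K \<Longrightarrow> H A \<le> H B" "\<And>x. x \<in> K \<Longrightarrow> g x \<le> h x"
  shows "choquet_integral H K g \<le> choquet_integral H K h"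
  unfolding choquet_integral_def
  using assms(2) by (intro nn_integral_mono mult_right_mono assms(1)) (auto intro: less_le_trans)

locale pcf_content = pcf_self_similar +
  fixes s \<alpha> :: real
  assumes \<alpha>: "0 < \<alpha>" "\<alpha> < s"
begin

abbreviation \<beta> :: real where "\<beta> \<equiv> \<alpha> / s"

abbreviation H :: "'a set \<Rightarrow> ennreal" where "H \<equiv> hausdorff_content m S K \<mu> s \<alpha>"

abbreviation wt :: "nat list \<Rightarrow> ennreal" where "wt w \<equiv> ennreal (measure \<mu> (Q w) powr \<beta>)"

lemma \<beta>_bounds: "0 < \<beta>" "\<beta> < 1"
  using \<alpha> by auto

lemma basic_cubes_eq: "basic_cubes m S K = Q ` W"
  by (auto simp: basic_cubes_def words_def)

lemma content_mono: "A \<subseteq> B \<Longrightarrow> H A \<le> H B"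
  unfolding hausdorff_content_def by (rule INF_superset_mono) auto

lemma content_le_cover:
  assumes "V \<subseteq> W" "E \<subseteq> (\<Union>v\<in>V. Q v)"
  shows "H E \<le> (\<integral>\<^sup>+v. wt v \<partial>count_space V)"
proof -
  have "H E \<le> (\<integral>\<^sup>+j. ennreal (measure \<mu> (Q (from_nat j)) powr \<beta>) \<partial>count_space (to_nat ` V))"
    unfolding hausdorff_content_def
    by (rule INF_lower2[of "(to_nat ` V, \<lambda>j. Q (from_nat j))"])
      (use assms in \<open>auto simp: basic_cubes_eq\<close>)
  also have "\<dots> = (\<integral>\<^sup>+v. wt v \<partial>count_space V)"
    by (subst nn_integral_bij_count_space[of to_nat V, symmetric]) (auto simp: bij_betw_def)
  finally show ?thesis .
qed

lemma cover_of_content: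
  assumes "E \<subseteq> K" "0 < e"
  obtains V where "V \<subseteq> W" "E \<subseteq> (\<Union>v\<in>V. Q v)" "(\<integral>\<^sup>+v. wt v \<partial>count_space V) \<le> H E + e"
proof (cases "H E = \<infinity>")
  case True
  then show thesis using assms by (intro that[of "{[]}"]) auto
next
  case False
  then have "H E < H E + e"
    using assms(2) by (simp add: ennreal_add_left_cancel_less less_top pos_add_strict)
  then obtain J I where JI: "\<forall>j\<in>J. I j \<in> basic_cubes m S K" "E \<subseteq> (\<Union>j\<in>J. I j)"
    "(\<integral>\<^sup>+j. ennreal (measure \<mu> (I j) powr \<beta>) \<partial>count_space (J :: nat set)) < H E + e"
    unfolding hausdorff_content_def INF_less_iff by auto
  then obtain v where v: "\<And>j. j \<in> J \<Longrightarrow> v j \<in> W \<and> I j = Q (v j)"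
    unfolding basic_cubes_eq image_iff by metis
  have "(\<integral>\<^sup>+v. wt v \<partial>count_space (v ` J)) \<le> (\<integral>\<^sup>+j. wt (v j) \<partial>count_space J)"
    by (rule nn_integral_count_space_image_le)
  also have "\<dots> = (\<integral>\<^sup>+j. ennreal (measure \<mu> (I j) powr \<beta>) \<partial>count_space J)"
    using v by (intro nn_integral_cong) auto
  finally have "(\<integral>\<^sup>+v. wt v \<partial>count_space (v ` J)) \<le> H E + e"
    using JI(3) by simp
  moreover have "v ` J \<subseteq> W" "E \<subseteq> (\<Union>v\<in>v ` J. Q v)"
    using v JI(2) by auto
  ultimately show thesis by (rule that[rotated 2])
qed

text \<open>Countable sets have content zero: each of their points lies in cubes of arbitrarily small measure.\<close>

lemma countable_cover_small:
  assumes C: "countable C" "C \<subseteq> K" and e: "0 < e"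
  obtains V where "V \<subseteq> W" "C \<subseteq> (\<Union>v\<in>V. Q v)" "(\<integral>\<^sup>+v. wt v \<partial>count_space V) \<le> ennreal e"
proof -
  have "\<exists>w. w \<in> W \<and> x \<in> Q w \<and> wt w \<le> ennreal (e * (1/2) ^ Suc (to_nat_on C x))" if x: "x \<in> C" for x
  proof -
    let ?d = "e * (1/2) ^ Suc (to_nat_on C x)"
    have d: "0 < ?d" using e by simp
    then have dp: "0 < ?d powr (1 / \<beta>)" using e by simp
    obtain w where w: "w \<in> W" "x \<in> Q w" "measure \<mu> (Q w) < ?d powr (1 / \<beta>)"
      using small_cube[OF subsetD[OF C(2) x] dp] by blast
    have "measure \<mu> (Q w) powr \<beta> \<le> (?d powr (1 / \<beta>)) powr \<beta>"
      using w \<beta>_bounds by (intro powr_mono2) auto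
    also have "\<dots> = ?d" using d \<alpha> by (simp add: powr_powr)
    finally show ?thesis using w(1,2) ennreal_leI by blast
  qed
  then obtain v where v: "\<And>x. x \<in> C \<Longrightarrow> v x \<in> W \<and> x \<in> Q (v x) \<and> wt (v x) \<le> ennreal (e * (1/2) ^ Suc (to_nat_on C x))"
    by metis
  have "(\<integral>\<^sup>+v. wt v \<partial>count_space (v ` C)) \<le> (\<integral>\<^sup>+x. wt (v x) \<partial>count_space C)"
    by (rule nn_integral_count_space_image_le)
  also have "\<dots> \<le> (\<integral>\<^sup>+x. ennreal (e * (1/2) ^ Suc (to_nat_on C x)) \<partial>count_space C)"
    using v by (intro nn_integral_mono) auto
  also have "\<dots> = (\<integral>\<^sup>+n. ennreal (e * (1/2) ^ Suc n) \<partial>count_space (to_nat_on C ` C))"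
    using C by (intro nn_integral_bij_count_space) (auto simp: bij_betw_def)
  also have "\<dots> \<le> (\<integral>\<^sup>+n. ennreal (e * (1/2) ^ Suc n) \<partial>count_space UNIV)"
    by (rule nn_integral_count_space_mono_set) auto
  also have "\<dots> = ennreal (e * 1)"
    unfolding nn_integral_count_space_nat
    using e sums_mult[OF power_half_series, of e] by (intro suminf_ennreal_eq) auto
  finally have "(\<integral>\<^sup>+v. wt v \<partial>count_space (v ` C)) \<le> ennreal e" by simp
  moreover have "v ` C \<subseteq> W" "C \<subseteq> (\<Union>v\<in>v ` C. Q v)"
    using v by auto
  ultimately show thesis by (rule that[rotated 2])
qed

text \<open>The double points form a countable set, so covers may ignore them. From here on the cubes behave
like the nodes of a tree.\<close>

lemma content_le_cover_off_double_points:
  assumes V: "V \<subseteq> W" and E: "E \<subseteq> K" "E \<subseteq> (\<Union>v\<in>V. Q v) \<union> double_points"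
  shows "H E \<le> (\<integral>\<^sup>+v. wt v \<partial>count_space V)"
proof (rule ennreal_le_epsilon)
  fix e :: real assume e: "0 < e"
  have "countable (double_points \<inter> K)"
    using countable_double_points by (rule countable_subset[rotated]) auto
  from countable_cover_small[OF this Int_lower2 e]
  obtain U where U: "U \<subseteq> W" "double_points \<inter> K \<subseteq> (\<Union>v\<in>U. Q v)"
    "(\<integral>\<^sup>+v. wt v \<partial>count_space U) \<le> ennreal e" by blast
  have "H E \<le> (\<integral>\<^sup>+v. wt v \<partial>count_space (V \<union> U))"
  proof (rule content_le_cover)
    show "V \<union> U \<subseteq> W" using V U(1) by (rule Un_least)
    show "E \<subseteq> (\<Union>v\<in>V \<union> U. Q v)" using E U(2) unfolding UN_Un by blast
  qed
  also have "\<dots> \<le> (\<integral>\<^sup>+v. wt v * indicator V v + wt v * indicator U v \<partial>count_space UNIV)"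
    by (auto simp: nn_integral_count_space_indicator split: split_indicator intro!: nn_integral_mono)
  also have "\<dots> = (\<integral>\<^sup>+v. wt v \<partial>count_space V) + (\<integral>\<^sup>+v. wt v \<partial>count_space U)"
    by (simp add: nn_integral_add nn_integral_count_space_indicator)
  also have "\<dots> \<le> (\<integral>\<^sup>+v. wt v \<partial>count_space V) + ennreal e"
    using U(3) by (rule add_left_mono)
  finally show "H E \<le> (\<integral>\<^sup>+v. wt v \<partial>count_space V) + ennreal e" .
qed

text \<open>Off the double points the cubes that contain \<open>x\<close> form the single branch given by a coding of \<open>x\<close>.\<close>

lemma nn_integral_words_eq_suminf:
  assumes x: "x \<in> K" "x \<notin> double_points"
    and \<omega>: "\<omega> \<in> infinite_words m" "\<And>n. x \<in> Q (map \<omega> [0..<n])"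
  shows "(\<integral>\<^sup>+u. c u * indicator (Q u) x \<partial>count_space W) = (\<Sum>n. c (map \<omega> [0..<n]))"
proof -
  let ?p = "\<lambda>n. map \<omega> [0..<n]"
  have eq: "u = ?p (length u)" if "u \<in> W" "x \<in> Q u" for u
    using comparable_off_double_points[OF that(1) prefix_W[OF \<omega>(1), of "length u"] _ that(2) \<omega>(2) x(2)]
    by simp
  have "(\<integral>\<^sup>+u. c u * indicator (Q u) x \<partial>count_space W)
      = (\<integral>\<^sup>+u. c u * indicator (Q u) x * indicator W u \<partial>count_space UNIV)"
    by (simp add: nn_integral_count_space_indicator)
  also have "\<dots> = (\<integral>\<^sup>+u. c u * indicator (range ?p) u \<partial>count_space UNIV)"
  proof (rule nn_integral_cong)
    fix u
    have "u \<in> range ?p \<longleftrightarrow> u \<in> W \<and> x \<in> Q u"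
      using eq[of u] prefix_W[OF \<omega>(1)] \<omega>(2) by (metis (no_types, lifting) rangeE rangeI)
    then show "c u * indicator (Q u) x * indicator W u = c u * indicator (range ?p) u"
      by (auto split: split_indicator)
  qed
  also have "\<dots> = (\<integral>\<^sup>+u. c u \<partial>count_space (range ?p))"
    by (simp add: nn_integral_count_space_indicator)
  also have "\<dots> = (\<integral>\<^sup>+n. c (?p n) \<partial>count_space UNIV)"
  proof (rule nn_integral_bij_count_space[symmetric])
    have "inj ?p" by (rule injI) (metis length_map length_upt minus_nat.diff_0)
    then show "bij_betw ?p UNIV (range ?p)" by (simp add: bij_betw_def)
  qed
  finally show ?thesis by (simp add: nn_integral_count_space_nat)
qed

text \<open>A stopping time argument. The partial sums of the combination along a branch increase; a point
where the total exceeds \<open>t\<close> lies in the cube \<open>Q w\<close> at which the partial sum first exceeds \<open>t\<close>. Here \<open>pre w\<close>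
is the partial sum strictly before \<open>w\<close>.\<close>

lemma superlevel_content_le:
  fixes c :: "nat list \<Rightarrow> ennreal"
  defines "pre \<equiv> \<lambda>w. \<Sum>k<length w. c (take k w)"
  shows "H {x \<in> K. ennreal t < (\<integral>\<^sup>+u. c u * indicator (Q u) x \<partial>count_space W)}
    \<le> (\<integral>\<^sup>+w. wt w \<partial>count_space {w \<in> W. pre w \<le> ennreal t \<and> ennreal t < pre w + c w})"
proof (rule content_le_cover_off_double_points)
  show "{x \<in> K. ennreal t < (\<integral>\<^sup>+u. c u * indicator (Q u) x \<partial>count_space W)}
      \<subseteq> (\<Union>v\<in>{w \<in> W. pre w \<le> ennreal t \<and> ennreal t < pre w + c w}. Q v) \<union> double_points"
  proof
    fix x assume x: "x \<in> {x \<in> K. ennreal t < (\<integral>\<^sup>+u. c u * indicator (Q u) x \<partial>count_space W)}"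
    show "x \<in> (\<Union>v\<in>{w \<in> W. pre w \<le> ennreal t \<and> ennreal t < pre w + c w}. Q v) \<union> double_points"
    proof (cases "x \<in> double_points")
      case False
      obtain \<omega> where \<omega>: "\<omega> \<in> infinite_words m" "\<And>n. x \<in> Q (map \<omega> [0..<n])"
        using coding_exists x by blast
      let ?p = "\<lambda>n. map \<omega> [0..<n]"
      have "ennreal t < (\<Sum>n. c (?p n))"
        using x nn_integral_words_eq_suminf[OF _ False \<omega>] by simp
      also have "\<dots> = (SUP n. \<Sum>k<n. c (?p k))"
        by (rule suminf_eq_SUP)
      finally obtain n0 where n0: "ennreal t < (\<Sum>k<n0. c (?p k))"
        by (auto simp: less_SUP_iff)
      define n where "n = (LEAST n. ennreal t < (\<Sum>k<n. c (?p k)))"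
      have n: "ennreal t < (\<Sum>k<n. c (?p k))"
        unfolding n_def using n0 by (rule LeastI)
      then have "n \<noteq> 0" by (intro notI) simp
      then obtain l where l: "n = Suc l" by (cases n) auto
      have "(\<Sum>k<l. c (?p k)) \<le> ennreal t"
        using not_less_Least[of l "\<lambda>n. ennreal t < (\<Sum>k<n. c (?p k))"] l unfolding n_def[symmetric]
        by (simp add: not_less)
      moreover have "pre (?p l) = (\<Sum>k<l. c (?p k))"
        unfolding pre_def by (auto simp: take_map min_def intro!: sum.cong)
      ultimately have "pre (?p l) \<le> ennreal t \<and> ennreal t < pre (?p l) + c (?p l)"
        using n l by simp
      then show ?thesis using \<omega> prefix_W[OF \<omega>(1)] by blast
    qed simp
  qed
qed auto

text \<open>Sublinearity of a Choquet integral usually rests on strong subadditivity of the set function. For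
combinations of cubes there is a direct argument: in the cover of the
superlevel set at height \<open>t\<close> given by the stopping rule, the cube \<open>Q w\<close> occurs only for \<open>t\<close> in an
interval of length \<open>c w\<close>, so integration over \<open>t\<close> multiplies its weight by at most \<open>c w\<close>.\<close>

lemma choquet_integral_cube_combination_le:
  fixes c :: "nat list \<Rightarrow> ennreal"
  shows "choquet_integral H K (\<lambda>x. \<integral>\<^sup>+u. c u * indicator (Q u) x \<partial>count_space W)
    \<le> (\<integral>\<^sup>+u. c u * wt u \<partial>count_space W)"
proof -
  define pre where "pre w = (\<Sum>k<length w. c (take k w))" for w
  let ?L = "\<lambda>w. {t. 0 < t \<and> pre w \<le> ennreal t \<and> ennreal t < pre w + c w}"
  have [measurable]: "?L w \<in> sets lborel" for w by measurable
  have "choquet_integral H K (\<lambda>x. \<integral>\<^sup>+u. c u * indicator (Q u) x \<partial>count_space W)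
      \<le> (\<integral>\<^sup>+t. (\<integral>\<^sup>+w. wt w * indicator (?L w) t \<partial>count_space W) \<partial>lborel)"
    unfolding choquet_integral_def
  proof (rule nn_integral_mono)
    fix t :: real
    let ?V = "{w \<in> W. pre w \<le> ennreal t \<and> ennreal t < pre w + c w}"
    have "(\<integral>\<^sup>+w. wt w \<partial>count_space ?V) = (\<integral>\<^sup>+w. wt w * indicator (?L w) t \<partial>count_space W)" if "0 < t"
      using that by (auto simp: nn_integral_count_space_indicator split: split_indicator intro!: nn_integral_cong)
    then show "H {x \<in> K. ennreal t < (\<integral>\<^sup>+u. c u * indicator (Q u) x \<partial>count_space W)} * indicator {0<..} t
        \<le> (\<integral>\<^sup>+w. wt w * indicator (?L w) t \<partial>count_space W)"
      using superlevel_content_le[of t c] by (auto simp: pre_def split: split_indicator)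
  qed
  also have "\<dots> = (\<integral>\<^sup>+w. (\<integral>\<^sup>+t. wt w * indicator (?L w) t \<partial>lborel) \<partial>count_space W)"
    by (rule nn_integral_count_space_nn_integral) auto
  also have "\<dots> = (\<integral>\<^sup>+w. wt w * emeasure lborel (?L w) \<partial>count_space W)"
    by (intro nn_integral_cong nn_integral_cmult_indicator) auto
  also have "\<dots> \<le> (\<integral>\<^sup>+u. c u * wt u \<partial>count_space W)"
  proof (rule nn_integral_mono)
    fix w
    show "wt w * emeasure lborel (?L w) \<le> c w * wt w"
      using mult_left_mono[OF emeasure_lborel_stopping_levels, of "wt w" "pre w" "c w"] by (simp add: mult.commute)
  qed
  finally show ?thesis .
qed

end

lemma borel_measurable_nn_integral_count_space:
  fixes f :: "'i \<Rightarrow> 'a \<Rightarrow> ennreal"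
  assumes "countable J" "\<And>j. j \<in> J \<Longrightarrow> f j \<in> borel_measurable M"
  shows "(\<lambda>x. \<integral>\<^sup>+j. f j x \<partial>count_space J) \<in> borel_measurable M"
proof -
  have "(\<lambda>z. f (snd z) (fst z)) \<in> borel_measurable (M \<Otimes>\<^sub>M count_space J)"
    using assms by (intro measurable_compose_countable'[where f="\<lambda>j z. f j (fst z)" and g=snd and I=J])
      (auto intro: measurable_compose[OF measurable_fst])
  then show ?thesis
    using sigma_finite_measure.borel_measurable_nn_integral[OF sigma_finite_measure_count_space_countable[OF assms(1)],
        of "\<lambda>x j. f j x" M]
    by (simp add: case_prod_beta)
qed

context pcf_content
begin

section \<open>Averages of the indicator of a basic cube\<close>

text \<open>The mean of the indicator function of \<open>Q v\<close> over the larger cube \<open>Q (take k v)\<close>.\<close>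

definition prefix_average :: "nat list \<Rightarrow> nat \<Rightarrow> real" where
  "prefix_average v k = measure \<mu> (Q v) / measure \<mu> (Q (take k v))"

text \<open>The coefficients that turn the powers \<open>prefix_average v k powr \<theta>\<close>, which increase with \<open>k\<close>, into sums over
the nested cubes \<open>Q (take 0 v)\<close>, \<open>Q (take 1 v)\<close>, \<open>\<dots>\<close>, \<open>Q v\<close>.\<close>

definition average_increment :: "real \<Rightarrow> nat list \<Rightarrow> nat \<Rightarrow> real" where
  "average_increment \<theta> v k = prefix_average v k powr \<theta> - (if k = 0 then 0 else prefix_average v (k - 1) powr \<theta>)"

lemma prefix_average_nonneg: "0 \<le> prefix_average v k"
  by (simp add: prefix_average_def)

lemma measure_cube_le_take: "v \<in> W \<Longrightarrow> measure \<mu> (Q v) \<le> measure \<mu> (Q (take k v))"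
  using finite_measure_mono[OF cube_subset_take cube_sets[OF take_W]] by simp

lemma prefix_average_mono:
  assumes v: "v \<in> W" and "j \<le> k"
  shows "prefix_average v j \<le> prefix_average v k"
proof (cases "measure \<mu> (Q v) = 0")
  case False
  then have "0 < measure \<mu> (Q v)" by (simp add: zero_less_measure_iff)
  moreover have "measure \<mu> (Q (take k v)) \<le> measure \<mu> (Q (take j v))"
    using finite_measure_mono[OF cube_take_mono[OF assms] cube_sets[OF take_W[OF v]]] .
  moreover have "measure \<mu> (Q v) \<le> measure \<mu> (Q (take k v))"
    using measure_cube_le_take[OF v] .
  ultimately show ?thesis
    unfolding prefix_average_def by (intro divide_left_mono mult_pos_pos) auto
qed (simp add: prefix_average_def)

lemma average_increment_nonneg: "v \<in> W \<Longrightarrow> 0 \<le> \<theta> \<Longrightarrow> 0 \<le> average_increment \<theta> v k"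
  using powr_mono2[of \<theta> "prefix_average v (k - 1)" "prefix_average v k"] prefix_average_mono[of v "k - 1" k] prefix_average_nonneg
  by (auto simp: average_increment_def)

lemma sum_average_increment: "(\<Sum>k\<le>n. average_increment \<theta> v k) = prefix_average v n powr \<theta>"
  by (induction n) (auto simp: average_increment_def)

text \<open>If \<open>Q w\<close> meets \<open>Q v\<close> in positive measure, one of the two words is a prefix of the other, and then the mean
of the indicator of \<open>Q v\<close> over \<open>Q w\<close> is at most \<open>prefix_average v n\<close>, where \<open>n\<close> is the smaller length. A
point of \<open>Q w\<close> lies in all the cubes \<open>Q (take k v)\<close> with \<open>k \<le> n\<close>, whose coefficients add up to
this power. The bound is a combination of cubes that does not mention \<open>w\<close>, hence it controls the
maximal function of the indicator of \<open>Q v\<close>.\<close>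

lemma average_indicator_powr_le:
  assumes v: "v \<in> W" and w: "w \<in> W" and x: "x \<in> Q w" and \<theta>: "0 < \<theta>"
  shows "(measure \<mu> (Q v \<inter> Q w) / measure \<mu> (Q w)) powr \<theta>
    \<le> (\<Sum>k\<le>length v. average_increment \<theta> v k * indicator (Q (take k v)) x)"
proof (cases "measure \<mu> (Q v \<inter> Q w) = 0")
  case True
  have "0 \<le> (\<Sum>k\<le>length v. average_increment \<theta> v k * indicator (Q (take k v)) x)"
    using \<theta> by (intro sum_nonneg mult_nonneg_nonneg average_increment_nonneg[OF v]) auto
  then show ?thesis unfolding True by simp
next
  case False
  then have pos: "0 < measure \<mu> (Q v \<inter> Q w)" by (simp add: zero_less_measure_iff)
  \<comment> \<open>A common point off the double points is what makes \<open>v\<close> and \<open>w\<close> comparable.\<close>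
  have "\<not> Q v \<inter> Q w \<subseteq> double_points"
  proof
    assume "Q v \<inter> Q w \<subseteq> double_points"
    moreover have "Q v \<inter> Q w \<in> sets \<mu>"
      by (intro sets.Int cube_sets v w)
    ultimately have "Q v \<inter> Q w \<in> null_sets \<mu>"
      using null_sets_subset[OF double_points_null] by blast
    then show False using False by (simp add: measure_eq_0_null_sets)
  qed
  then obtain y where y: "y \<in> Q v" "y \<in> Q w" "y \<notin> double_points" by blast
  define n where "n = min (length v) (length w)"
  have pv: "0 < measure \<mu> (Q v)" and pw: "0 < measure \<mu> (Q w)"
    using pos finite_measure_mono[of "Q v \<inter> Q w" "Q v"] finite_measure_mono[of "Q v \<inter> Q w" "Q w"]
      cube_sets[OF v] cube_sets[OF w] by auto
  have *: "Q w \<subseteq> Q (take n v) \<and> measure \<mu> (Q v \<inter> Q w) / measure \<mu> (Q w) \<le> prefix_average v n"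
  proof (cases "length v \<le> length w")
    case True
    then have "v = take (length v) w"
      using comparable_off_double_points[OF v w _ y] by simp
    then have "Q w \<subseteq> Q v" using cube_subset_take[OF w, of "length v"] by simp
    moreover have "measure \<mu> (Q v \<inter> Q w) \<le> measure \<mu> (Q w)"
      using cube_sets[OF w] by (intro finite_measure_mono) auto
    ultimately show ?thesis using True pv pw by (simp add: n_def prefix_average_def)
  next
    case False
    then have "w = take n v"
      using comparable_off_double_points[OF w v _ y(2,1,3)] by (simp add: n_def)
    moreover have "measure \<mu> (Q v \<inter> Q w) \<le> measure \<mu> (Q v)"
      using cube_sets[OF v] by (intro finite_measure_mono) auto
    ultimately show ?thesis by (simp add: prefix_average_def divide_right_mono)
  qed
  have "(measure \<mu> (Q v \<inter> Q w) / measure \<mu> (Q w)) powr \<theta> \<le> prefix_average v n powr \<theta>"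
    using * \<theta> by (intro powr_mono2) auto
  also have "\<dots> = (\<Sum>k\<le>n. average_increment \<theta> v k)" by (simp add: sum_average_increment)
  also have "\<dots> = (\<Sum>k\<le>n. average_increment \<theta> v k * indicator (Q (take k v)) x)"
  proof (rule sum.cong)
    fix k assume "k \<in> {..n}"
    then have "Q (take n v) \<subseteq> Q (take k v)" using cube_take_mono[OF v] by simp
    then have "x \<in> Q (take k v)" using x * by blast
    then show "average_increment \<theta> v k = average_increment \<theta> v k * indicator (Q (take k v)) x" by simp
  qed simp
  also have "\<dots> \<le> (\<Sum>k\<le>length v. average_increment \<theta> v k * indicator (Q (take k v)) x)"
    using average_increment_nonneg[OF v] \<theta> by (intro sum_mono2) (auto simp: n_def)
  finally show ?thesis .
qed

text \<open>Since \<open>measure \<mu> (Q (take k v)) = measure \<mu> (Q v) / prefix_average v k\<close>, each summand is an increment of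
\<open>t powr \<theta>\<close> times \<open>t powr (- \<beta>)\<close> at its right end point. Up to the factor \<open>measure \<mu> (Q v) powr \<beta>\<close>, the sum is thus a lower sum for
the integral of \<open>\<theta> t powr (\<theta> - 1 - \<beta>)\<close> over \<open>[0, 1]\<close>.\<close>

lemma sum_average_increment_weight_le:
  assumes v: "v \<in> W" and \<theta>: "\<beta> < \<theta>"
  shows "(\<Sum>k\<le>length v. average_increment \<theta> v k * measure \<mu> (Q (take k v)) powr \<beta>)
    \<le> \<theta> / (\<theta> - \<beta>) * measure \<mu> (Q v) powr \<beta>"
proof (cases "measure \<mu> (Q v) = 0")
  case True
  then have "average_increment \<theta> v k = 0" for k by (simp add: average_increment_def prefix_average_def)
  then show ?thesis using True by simp
next
  case False
  then have pv: "0 < measure \<mu> (Q v)" by (simp add: zero_less_measure_iff)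
  let ?M = "measure \<mu> (Q v)"
  have "average_increment \<theta> v k * measure \<mu> (Q (take k v)) powr \<beta>
      \<le> ?M powr \<beta> * (\<theta> / (\<theta> - \<beta>)) * average_increment (\<theta> - \<beta>) v k" for k
  proof -
    define x where "x = (if k = 0 then 0 else prefix_average v (k - 1))"
    have pk: "0 < measure \<mu> (Q (take k v))"
      using pv measure_cube_le_take[OF v, of k] by linarith
    then have y: "0 < prefix_average v k" using pv by (simp add: prefix_average_def)
    have x: "0 \<le> x" "x \<le> prefix_average v k"
      using prefix_average_nonneg prefix_average_mono[OF v, of "k - 1" k] by (auto simp: x_def)
    have inc: "average_increment \<gamma> v k = prefix_average v k powr \<gamma> - x powr \<gamma>" for \<gamma>
      by (simp add: average_increment_def x_def)
    have "measure \<mu> (Q (take k v)) = ?M / prefix_average v k"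
      using pv by (simp add: prefix_average_def)
    then have "measure \<mu> (Q (take k v)) powr \<beta> = ?M powr \<beta> * prefix_average v k powr (- \<beta>)"
      using y pv by (simp add: powr_divide powr_minus_divide)
    then have "average_increment \<theta> v k * measure \<mu> (Q (take k v)) powr \<beta>
        = ?M powr \<beta> * ((prefix_average v k powr \<theta> - x powr \<theta>) * prefix_average v k powr (- \<beta>))"
      by (simp add: inc)
    also have "\<dots> \<le> ?M powr \<beta> * (\<theta> / (\<theta> - \<beta>) * (prefix_average v k powr (\<theta> - \<beta>) - x powr (\<theta> - \<beta>)))"
      using powr_increment_bound[OF x y \<beta>_bounds(1) \<theta>] by (intro mult_left_mono) auto
    finally show ?thesis by (simp add: inc mult.assoc)
  qed
  then have "(\<Sum>k\<le>length v. average_increment \<theta> v k * measure \<mu> (Q (take k v)) powr \<beta>)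
      \<le> ?M powr \<beta> * (\<theta> / (\<theta> - \<beta>)) * (\<Sum>k\<le>length v. average_increment (\<theta> - \<beta>) v k)"
    unfolding sum_distrib_left by (rule sum_mono)
  also have "\<dots> = \<theta> / (\<theta> - \<beta>) * ?M powr \<beta>"
    using pv by (simp add: sum_average_increment prefix_average_def)
  finally show ?thesis .
qed

section \<open>The maximal operator on functions controlled by basic cubes\<close>

text \<open>The function is controlled through the largest of the numbers \<open>D j\<close>, not through their sum, so that
one family of cubes serves all exponents. With \<open>P = p / \<theta> = max p 1\<close> and \<open>\<kappa> = 1 / \<theta>\<close>, the mean of
\<open>\<bar>f\<bar> powr P\<close> over \<open>Q w\<close> is at most the sum of \<open>D j powr \<kappa>\<close> times the mean of the indicator of \<open>Q (v j)\<close>.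
Jensen's inequality for the exponent \<open>P\<close> and the subadditivity of the power \<open>\<theta>\<close> then bound
the \<open>p\<close>-th power of the mean of \<open>\<bar>f\<bar>\<close> by a sum of powers of means of indicators.\<close>

lemma maximal_operator_powr_le:
  fixes D :: "'j \<Rightarrow> real" and v :: "'j \<Rightarrow> nat list" and p :: real
  defines "\<theta> \<equiv> min p 1"
  assumes p: "0 < p" and J: "countable J"
    and D: "\<And>j. j \<in> J \<Longrightarrow> 0 \<le> D j" and v: "\<And>j. j \<in> J \<Longrightarrow> v j \<in> W"
    and f: "\<And>y. y \<in> K \<Longrightarrow> f y \<noteq> 0 \<Longrightarrow> \<exists>j\<in>J. y \<in> Q (v j) \<and> \<bar>f y\<bar> powr p \<le> D j"
  shows "ennreal_powr (maximal_operator m S K \<mu> f x) p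
    \<le> (\<integral>\<^sup>+j. ennreal (D j * (\<Sum>k\<le>length (v j). average_increment \<theta> (v j) k * indicator (Q (take k (v j))) x)) \<partial>count_space J)"
    (is "_ \<le> ?R")
proof (cases "?R = \<infinity>")
  case False
  then obtain T where T: "?R = ennreal T" "0 \<le> T"
    by (cases ?R rule: ennreal_cases) auto
  have \<theta>: "0 < \<theta>" "\<theta> \<le> 1" "\<theta> \<le> p" using p by (auto simp: \<theta>_def)
  define \<kappa> where "\<kappa> = 1 / \<theta>"
  have \<kappa>: "1 \<le> \<kappa>" "1 \<le> p * \<kappa>" "0 < \<kappa>" using \<theta> by (auto simp: \<kappa>_def)
  have "maximal_operator m S K \<mu> f x \<le> ennreal (T powr (1 / p))"
    unfolding maximal_operator_def
  proof (rule SUP_least)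
    fix w assume "w \<in> {w. \<exists>n\<ge>1. w \<in> words m n \<and> x \<in> Q w}"
    then have w: "w \<in> W" and x: "x \<in> Q w" by (auto simp: words_def)
    note [measurable] = cube_sets[OF w]
    show "(\<integral>\<^sup>+y\<in>Q w. ennreal \<bar>f y\<bar> \<partial>completion \<mu>) / emeasure \<mu> (Q w) \<le> ennreal (T powr (1 / p))"
    proof (cases "emeasure \<mu> (Q w) = 0")
      case True
      then have "AE y in \<mu>. y \<notin> Q w"
        using cube_sets[OF w] by (auto intro: AE_not_in simp: null_sets_def)
      then have "(\<integral>\<^sup>+y\<in>Q w. ennreal \<bar>f y\<bar> \<partial>\<mu>) = (\<integral>\<^sup>+y. 0 \<partial>\<mu>)"
        by (intro nn_integral_cong_AE) auto
      then show ?thesis by (simp add: nn_integral_completion)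
    next
      case False
      define \<rho> where "\<rho> j = measure \<mu> (Q (v j) \<inter> Q w) / measure \<mu> (Q w)" for j
      define h where "h y = (\<integral>\<^sup>+j. ennreal (D j powr \<kappa>) * indicator (Q (v j)) y \<partial>count_space J)" for y
      have h_meas [measurable]: "h \<in> borel_measurable \<mu>"
        unfolding h_def using cube_sets v J
        by (intro borel_measurable_nn_integral_count_space) auto
      have fh: "ennreal (\<bar>f y\<bar> powr (p * \<kappa>)) \<le> h y" if "y \<in> Q w" for y
      proof (cases "f y = 0")
        case False
        have "y \<in> K" using that cube_subset_K[OF w] by blast
        then obtain j where j: "j \<in> J" "y \<in> Q (v j)" "\<bar>f y\<bar> powr p \<le> D j"
          using f False by blast
        have "\<bar>f y\<bar> powr (p * \<kappa>) \<le> D j powr \<kappa>"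
          using j(3) \<kappa> unfolding powr_powr[symmetric] by (intro powr_mono2) auto
        then have "ennreal (\<bar>f y\<bar> powr (p * \<kappa>)) \<le> ennreal (D j powr \<kappa>) * indicator (Q (v j)) y"
          using j(2) by (simp add: ennreal_leI)
        also have "\<dots> \<le> h y"
          unfolding h_def by (rule nn_integral_ge_point[OF j(1)])
        finally show ?thesis .
      qed simp
      have "(\<integral>\<^sup>+j. ennreal (D j * \<rho> j powr \<theta>) \<partial>count_space J) \<le> ?R"
        using average_indicator_powr_le[OF v w x \<theta>(1)] D
        by (intro nn_integral_mono ennreal_leI mult_left_mono) (auto simp: \<rho>_def)
      then have "(\<integral>\<^sup>+j. ennreal ((D j * \<rho> j powr \<theta>) powr \<kappa>) \<partial>count_space J) \<le> ennreal (T powr \<kappa>)"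
        using D T \<kappa>(1) by (intro nn_integral_powr_le_powr_nn_integral) auto
      also have "(\<integral>\<^sup>+j. ennreal ((D j * \<rho> j powr \<theta>) powr \<kappa>) \<partial>count_space J)
          = (\<integral>\<^sup>+y\<in>Q w. h y \<partial>\<mu>) / emeasure \<mu> (Q w)"
      proof -
        have "(\<integral>\<^sup>+y\<in>Q w. h y \<partial>\<mu>) / emeasure \<mu> (Q w)
          = (\<integral>\<^sup>+y. (\<integral>\<^sup>+j. ennreal (D j powr \<kappa>) * indicator (Q (v j) \<inter> Q w) y \<partial>count_space J) \<partial>\<mu>) / emeasure \<mu> (Q w)"
          unfolding h_def
          by (intro arg_cong2[of _ _ _ _ "(/)"] nn_integral_cong refl)
            (simp add: nn_integral_multc[symmetric] indicator_inter_arith mult.assoc)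
        also have "\<dots> = (\<integral>\<^sup>+j. (\<integral>\<^sup>+y. ennreal (D j powr \<kappa>) * indicator (Q (v j) \<inter> Q w) y \<partial>\<mu>) \<partial>count_space J) / emeasure \<mu> (Q w)"
          using J v cube_sets by (subst nn_integral_count_space_nn_integral) auto
        also have "\<dots> = (\<integral>\<^sup>+j. ennreal (D j powr \<kappa>) * emeasure \<mu> (Q (v j) \<inter> Q w) \<partial>count_space J) / emeasure \<mu> (Q w)"
          using v cube_sets
          by (intro arg_cong2[of _ _ _ _ "(/)"] nn_integral_cong refl nn_integral_cmult_indicator) auto
        also have "\<dots> = (\<integral>\<^sup>+j. ennreal (D j powr \<kappa>) * emeasure \<mu> (Q (v j) \<inter> Q w) / emeasure \<mu> (Q w) \<partial>count_space J)"
          by (rule nn_integral_divide[symmetric]) auto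
        also have "\<dots> = (\<integral>\<^sup>+j. ennreal ((D j * \<rho> j powr \<theta>) powr \<kappa>) \<partial>count_space J)"
        proof (rule nn_integral_cong)
          fix j assume "j \<in> space (count_space J)"
          then have j: "0 \<le> D j" using D by simp
          have pw: "0 < measure \<mu> (Q w)"
            using False by (simp add: emeasure_eq_measure zero_less_measure_iff)
          have "(D j * \<rho> j powr \<theta>) powr \<kappa> = D j powr \<kappa> * \<rho> j"
            using j \<theta> by (simp add: powr_mult powr_powr \<kappa>_def \<rho>_def)
          then show "ennreal (D j powr \<kappa>) * emeasure \<mu> (Q (v j) \<inter> Q w) / emeasure \<mu> (Q w)
            = ennreal ((D j * \<rho> j powr \<theta>) powr \<kappa>)"
            using pw by (simp add: emeasure_eq_measure ennreal_mult[symmetric] divide_ennreal \<rho>_def)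
        qed
        finally show ?thesis by simp
      qed
      finally have avg: "(\<integral>\<^sup>+y\<in>Q w. h y \<partial>\<mu>) / emeasure \<mu> (Q w) \<le> ennreal (T powr \<kappa>)" .
      have "(\<integral>\<^sup>+y\<in>Q w. ennreal \<bar>f y\<bar> \<partial>\<mu>) / emeasure \<mu> (Q w) \<le> ennreal (T powr (1 / p))"
      \<comment> \<open>The number compared with the mean must be positive, and \<open>T\<close> may be zero.\<close>
      proof (rule ennreal_le_epsilon)
        fix e :: real assume e: "0 < e"
        let ?a = "T powr (1 / p) + e"
        have a: "0 < ?a" using e by (simp add: add_nonneg_pos)
        have "T = (T powr (1 / p)) powr p" using T p by (cases "T = 0") (auto simp: powr_powr)
        also have "\<dots> \<le> ?a powr p" using e p by (intro powr_mono2) auto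
        finally have "T powr \<kappa> \<le> (?a powr p) powr \<kappa>" using T \<kappa> by (intro powr_mono2) auto
        then have "(\<integral>\<^sup>+y\<in>Q w. h y \<partial>\<mu>) / emeasure \<mu> (Q w) \<le> ennreal (?a powr (p * \<kappa>))"
          using avg by (auto simp: powr_powr intro: order_trans ennreal_leI)
        then have "(\<integral>\<^sup>+y\<in>Q w. ennreal \<bar>f y\<bar> \<partial>\<mu>) / emeasure \<mu> (Q w) \<le> ennreal ?a"
          using False a \<kappa> fh cube_sets[OF w]
          by (intro average_le_of_average_powr_le[where h=h and P="p * \<kappa>"])
            (auto simp: emeasure_eq_measure zero_less_iff_neq_zero)
        then show "(\<integral>\<^sup>+y\<in>Q w. ennreal \<bar>f y\<bar> \<partial>\<mu>) / emeasure \<mu> (Q w) \<le> ennreal (T powr (1 / p)) + ennreal e"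
          using e by (simp add: ennreal_plus[symmetric] del: ennreal_plus)
      qed
      then show ?thesis by (simp add: nn_integral_completion)
    qed
  qed
  then show ?thesis
    using ennreal_powr_le T p by simp
qed simp

text \<open>The pointwise bound of the preceding lemma, regrouped according to the cubes that occur in it, is a
combination of cubes with coefficients \<open>c\<close>, whose Choquet integral is known to be at most the
weighted sum of the coefficients.\<close>

lemma choquet_integral_maximal_operator_le:
  fixes D :: "'j \<Rightarrow> real" and v :: "'j \<Rightarrow> nat list" and p :: real
  defines "\<theta> \<equiv> min p 1"
  assumes p: "\<beta> < p" and J: "countable J"
    and D: "\<And>j. j \<in> J \<Longrightarrow> 0 \<le> D j" and v: "\<And>j. j \<in> J \<Longrightarrow> v j \<in> W"
    and f: "\<And>y. y \<in> K \<Longrightarrow> f y \<noteq> 0 \<Longrightarrow> \<exists>j\<in>J. y \<in> Q (v j) \<and> \<bar>f y\<bar> powr p \<le> D j"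
  shows "choquet_integral H K (\<lambda>x. ennreal_powr (maximal_operator m S K \<mu> f x) p)
    \<le> ennreal (\<theta> / (\<theta> - \<beta>)) * (\<integral>\<^sup>+j. ennreal (D j) * wt (v j) \<partial>count_space J)"
proof -
  have \<theta>: "\<beta> < \<theta>" "0 < \<theta>" using p \<beta>_bounds by (auto simp: \<theta>_def)
  define c where "c u = (\<integral>\<^sup>+j. ennreal (D j) *
      (\<Sum>k\<le>length (v j). ennreal (average_increment \<theta> (v j) k) * indicator {take k (v j)} u) \<partial>count_space J)" for u
  have inc: "0 \<le> average_increment \<theta> (v j) k" if "j \<in> J" for j k
    using average_increment_nonneg[OF v[OF that]] \<theta> by simp
  have swap: "(\<integral>\<^sup>+u. c u * F u \<partial>count_space W)
      = (\<integral>\<^sup>+j. ennreal (D j) * (\<Sum>k\<le>length (v j). ennreal (average_increment \<theta> (v j) k) * F (take k (v j))) \<partial>count_space J)" for F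
  proof -
    have "(\<integral>\<^sup>+u. c u * F u \<partial>count_space W) = (\<integral>\<^sup>+u. (\<integral>\<^sup>+j. ennreal (D j) *
      (\<Sum>k\<le>length (v j). ennreal (average_increment \<theta> (v j) k) * F u * indicator {take k (v j)} u) \<partial>count_space J) \<partial>count_space W)"
    proof (rule nn_integral_cong)
      fix u
      have "c u * F u = (\<integral>\<^sup>+j. ennreal (D j) *
        (\<Sum>k\<le>length (v j). ennreal (average_increment \<theta> (v j) k) * indicator {take k (v j)} u) * F u \<partial>count_space J)"
        unfolding c_def by (rule nn_integral_multc[symmetric]) simp
      then show "c u * F u = (\<integral>\<^sup>+j. ennreal (D j) *
        (\<Sum>k\<le>length (v j). ennreal (average_increment \<theta> (v j) k) * F u * indicator {take k (v j)} u) \<partial>count_space J)"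
        by (simp only: mult.assoc sum_distrib_right mult.commute[of "F u"])
    qed
    also have "\<dots> = (\<integral>\<^sup>+j. (\<integral>\<^sup>+u. ennreal (D j) *
      (\<Sum>k\<le>length (v j). ennreal (average_increment \<theta> (v j) k) * F u * indicator {take k (v j)} u) \<partial>count_space W) \<partial>count_space J)"
      by (rule nn_integral_count_space_nn_integral[OF J]) simp
    also have "\<dots> = (\<integral>\<^sup>+j. ennreal (D j) * (\<Sum>k\<le>length (v j). ennreal (average_increment \<theta> (v j) k) * F (take k (v j))) \<partial>count_space J)"
    proof (rule nn_integral_cong)
      fix j assume "j \<in> space (count_space J)"
      then have "take k (v j) \<in> W" for k using take_W v by simp
      then have single: "(\<integral>\<^sup>+u. ennreal (average_increment \<theta> (v j) k) * F u * indicator {take k (v j)} u \<partial>count_space W)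
          = ennreal (average_increment \<theta> (v j) k) * F (take k (v j))" for k
        by (subst nn_integral_indicator_singleton) auto
      show "(\<integral>\<^sup>+u. ennreal (D j) *
          (\<Sum>k\<le>length (v j). ennreal (average_increment \<theta> (v j) k) * F u * indicator {take k (v j)} u) \<partial>count_space W)
        = ennreal (D j) * (\<Sum>k\<le>length (v j). ennreal (average_increment \<theta> (v j) k) * F (take k (v j)))"
        unfolding single[symmetric]
        by (subst nn_integral_sum[symmetric], simp, rule nn_integral_cmult, simp)
    qed
    finally show ?thesis .
  qed
  have "ennreal_powr (maximal_operator m S K \<mu> f x) p \<le> (\<integral>\<^sup>+u. c u * indicator (Q u) x \<partial>count_space W)" for x
  proof -
    have "ennreal_powr (maximal_operator m S K \<mu> f x) p
      \<le> (\<integral>\<^sup>+j. ennreal (D j * (\<Sum>k\<le>length (v j). average_increment \<theta> (v j) k * indicator (Q (take k (v j))) x)) \<partial>count_space J)"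
      unfolding \<theta>_def using p \<beta>_bounds by (intro maximal_operator_powr_le[OF _ J D v f]) auto
    also have "\<dots> = (\<integral>\<^sup>+u. c u * indicator (Q u) x \<partial>count_space W)"
      unfolding swap
    proof (rule nn_integral_cong)
      fix j assume "j \<in> space (count_space J)"
      then have j: "j \<in> J" by simp
      have "ennreal (\<Sum>k\<le>length (v j). average_increment \<theta> (v j) k * indicator (Q (take k (v j))) x)
        = (\<Sum>k\<le>length (v j). ennreal (average_increment \<theta> (v j) k) * indicator (Q (take k (v j))) x)"
        using inc[OF j] by (subst sum_ennreal[symmetric]) (auto simp: ennreal_mult ennreal_indicator)
      then show "ennreal (D j * (\<Sum>k\<le>length (v j). average_increment \<theta> (v j) k * indicator (Q (take k (v j))) x))
        = ennreal (D j) * (\<Sum>k\<le>length (v j). ennreal (average_increment \<theta> (v j) k) * indicator (Q (take k (v j))) x)"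
        using D[OF j] inc[OF j] by (simp add: ennreal_mult sum_nonneg)
    qed
    finally show ?thesis .
  qed
  then have "choquet_integral H K (\<lambda>x. ennreal_powr (maximal_operator m S K \<mu> f x) p)
      \<le> choquet_integral H K (\<lambda>x. \<integral>\<^sup>+u. c u * indicator (Q u) x \<partial>count_space W)"
    by (intro choquet_integral_mono content_mono)
  also have "\<dots> \<le> (\<integral>\<^sup>+u. c u * wt u \<partial>count_space W)"
    by (rule choquet_integral_cube_combination_le)
  also have "\<dots> \<le> (\<integral>\<^sup>+j. ennreal (\<theta> / (\<theta> - \<beta>)) * (ennreal (D j) * wt (v j)) \<partial>count_space J)"
    unfolding swap
  proof (rule nn_integral_mono)
    fix j assume "j \<in> space (count_space J)"
    then have j: "j \<in> J" by simp
    have "(\<Sum>k\<le>length (v j). ennreal (average_increment \<theta> (v j) k) * wt (take k (v j)))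
      = ennreal (\<Sum>k\<le>length (v j). average_increment \<theta> (v j) k * measure \<mu> (Q (take k (v j))) powr \<beta>)"
      using inc[OF j] by (subst sum_ennreal[symmetric]) (auto simp: ennreal_mult)
    also have "\<dots> \<le> ennreal (\<theta> / (\<theta> - \<beta>) * measure \<mu> (Q (v j)) powr \<beta>)"
      by (intro ennreal_leI sum_average_increment_weight_le v[OF j] \<theta>)
    also have "\<dots> = ennreal (\<theta> / (\<theta> - \<beta>)) * wt (v j)"
      using \<theta> by (intro ennreal_mult) auto
    finally show "ennreal (D j) * (\<Sum>k\<le>length (v j). ennreal (average_increment \<theta> (v j) k) * wt (take k (v j)))
      \<le> ennreal (\<theta> / (\<theta> - \<beta>)) * (ennreal (D j) * wt (v j))"
      using mult_left_mono[of _ _ "ennreal (D j)"] by (simp add: mult.left_commute)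
  qed
  also have "\<dots> = ennreal (\<theta> / (\<theta> - \<beta>)) * (\<integral>\<^sup>+j. ennreal (D j) * wt (v j) \<partial>count_space J)"
    by (rule nn_integral_cmult) simp
  finally show ?thesis .
qed

section \<open>Dyadic level sets\<close>

text \<open>A lower sum: on the interval \<open>(2 powr (k - 1), 2 powr k]\<close> the content of the superlevel set at height
\<open>t\<close> is at least its value at the right end point.\<close>

lemma dyadic_sum_content_le_choquet_integral:
  "(\<integral>\<^sup>+k. ennreal (2 powr (of_int k - 1)) * H {x \<in> K. ennreal (2 powr of_int k) < g x} \<partial>count_space (UNIV :: int set))
    \<le> choquet_integral H K g"
proof -
  let ?E = "\<lambda>t. {x \<in> K. ennreal t < g x}"
  let ?I = "\<lambda>k::int. {2 powr (of_int k - 1)<..2 powr of_int k} :: real set"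
  have len: "emeasure lborel (?I k) = ennreal (2 powr (of_int k - 1))" for k
  proof -
    have "(2::real) powr of_int k = 2 * 2 powr (of_int k - 1)"
      by (simp add: powr_diff)
    then show ?thesis by simp
  qed
  have "(\<integral>\<^sup>+k. ennreal (2 powr (of_int k - 1)) * H (?E (2 powr of_int k)) \<partial>count_space (UNIV :: int set))
      = (\<integral>\<^sup>+k. (\<integral>\<^sup>+t. H (?E (2 powr of_int k)) * indicator (?I k) t \<partial>lborel) \<partial>count_space UNIV)"
  proof (rule nn_integral_cong)
    fix k :: int
    have "(\<integral>\<^sup>+t. H (?E (2 powr of_int k)) * indicator (?I k) t \<partial>lborel)
        = H (?E (2 powr of_int k)) * emeasure lborel (?I k)"
      by (rule nn_integral_cmult_indicator) simp
    then show "ennreal (2 powr (of_int k - 1)) * H (?E (2 powr of_int k))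
        = (\<integral>\<^sup>+t. H (?E (2 powr of_int k)) * indicator (?I k) t \<partial>lborel)"
      by (simp only: len mult.commute)
  qed
  also have "\<dots> = (\<integral>\<^sup>+t. (\<integral>\<^sup>+k. H (?E (2 powr of_int k)) * indicator (?I k) t \<partial>count_space UNIV) \<partial>lborel)"
    by (rule nn_integral_count_space_nn_integral[symmetric]) auto
  also have "\<dots> \<le> choquet_integral H K g"
    unfolding choquet_integral_def
  proof (rule nn_integral_mono)
    fix t :: real
    \<comment> \<open>The only level whose dyadic interval contains \<open>t\<close>, provided that \<open>t\<close> is positive.\<close>
    let ?n = "\<lceil>log 2 t\<rceil>"
    have eq: "t \<in> ?I k \<longleftrightarrow> 0 < t \<and> k = ?n" for k
    proof (cases "0 < t")
      case True
      then have "t \<in> ?I k \<longleftrightarrow> of_int k - 1 < log 2 t \<and> log 2 t \<le> of_int k"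
        by (simp add: less_log_iff log_le_iff)
      then show ?thesis using True by (auto simp: ceiling_eq_iff) linarith+
    next
      case False
      then show ?thesis by (auto dest: less_trans[OF powr_gt_zero[THEN iffD2], rotated])
    qed
    have "(\<integral>\<^sup>+k. H (?E (2 powr of_int k)) * indicator (?I k) t \<partial>count_space UNIV)
      \<le> (\<integral>\<^sup>+k. (H (?E t) * indicator {0<..} t) * indicator {?n} k \<partial>count_space UNIV)"
    proof (rule nn_integral_mono)
      fix k :: int
      show "H (?E (2 powr of_int k)) * indicator (?I k) t \<le> (H (?E t) * indicator {0<..} t) * indicator {?n} k"
      proof (cases "t \<in> ?I k")
        case True
        then have "?E (2 powr of_int k) \<subseteq> ?E t"
          by (auto intro: le_less_trans[OF ennreal_leI])
        then show ?thesis using True eq[of k] content_mono by simp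
      qed simp
    qed
    also have "\<dots> = H (?E t) * indicator {0<..} t"
      by (simp add: nn_integral_cmult)
    finally show "(\<integral>\<^sup>+k. H (?E (2 powr of_int k)) * indicator (?I k) t \<partial>count_space UNIV)
      \<le> H (?E t) * indicator {0<..} t" .
  qed
  finally show ?thesis .
qed

text \<open>Nearly optimal covers of all superlevel sets at heights \<open>2 powr k\<close>, where the cover at height
\<open>2 powr k\<close> is responsible for the points with \<open>g y\<close> between \<open>2 powr k\<close> and \<open>2 powr (k + 1)\<close>. The factor 4 is
\<open>2 powr (k + 1) / 2 powr (k - 1)\<close>.\<close>

lemma dyadic_cover:
  assumes e: "0 < e"
  obtains J :: "(int \<times> nat list) set" where
    "\<And>k v. (k, v) \<in> J \<Longrightarrow> v \<in> W"
    "\<And>y. y \<in> K \<Longrightarrow> 0 < g y \<Longrightarrow> \<exists>k v. (k, v) \<in> J \<and> y \<in> Q v \<and> g y \<le> 2 powr (of_int k + 1)"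
    "(\<integral>\<^sup>+(k, v). ennreal (2 powr (of_int k + 1)) * wt v \<partial>count_space J)
      \<le> 4 * choquet_integral H K (\<lambda>x. ennreal (g x)) + ennreal e"
proof -
  let ?E = "\<lambda>k::int. {x \<in> K. ennreal (2 powr of_int k) < ennreal (g x)}"
  \<comment> \<open>The division cancels the weight of the \<open>k\<close>-th cover, so that the errors add up to at most \<open>e\<close>.\<close>
  define \<epsilon> where "\<epsilon> k = e * (1/2) ^ Suc (to_nat k) / 2 powr (of_int k + 1)" for k :: int
  have "\<forall>k. \<exists>V. V \<subseteq> W \<and> ?E k \<subseteq> (\<Union>v\<in>V. Q v) \<and> (\<integral>\<^sup>+v. wt v \<partial>count_space V) \<le> H (?E k) + \<epsilon> k"
  proof
    fix k
    have "?E k \<subseteq> K" "0 < ennreal (\<epsilon> k)" using e by (auto simp: \<epsilon>_def)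
    then obtain V where "V \<subseteq> W" "?E k \<subseteq> (\<Union>v\<in>V. Q v)"
      "(\<integral>\<^sup>+v. wt v \<partial>count_space V) \<le> H (?E k) + \<epsilon> k"
      by (rule cover_of_content)
    then show "\<exists>V. V \<subseteq> W \<and> ?E k \<subseteq> (\<Union>v\<in>V. Q v) \<and> (\<integral>\<^sup>+v. wt v \<partial>count_space V) \<le> H (?E k) + \<epsilon> k"
      by (intro exI[of _ V] conjI)
  qed
  from choice[OF this] obtain V where
    "\<forall>k. V k \<subseteq> W \<and> ?E k \<subseteq> (\<Union>v\<in>V k. Q v) \<and> (\<integral>\<^sup>+v. wt v \<partial>count_space (V k)) \<le> H (?E k) + \<epsilon> k" ..
  then have V: "V k \<subseteq> W" "?E k \<subseteq> (\<Union>v\<in>V k. Q v)"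
    "(\<integral>\<^sup>+v. wt v \<partial>count_space (V k)) \<le> H (?E k) + \<epsilon> k" for k
    by simp_all
  define J where "J = {(k, v). v \<in> V k}"
  show thesis
  proof (rule that[of J])
    show "v \<in> W" if "(k, v) \<in> J" for k v
      using that V(1) by (auto simp: J_def)
    show "\<exists>k v. (k, v) \<in> J \<and> y \<in> Q v \<and> g y \<le> 2 powr (of_int k + 1)" if y: "y \<in> K" "0 < g y" for y
    proof -
      define k where "k = \<lceil>log 2 (g y)\<rceil> - 1"
      have "of_int k < log 2 (g y)" "log 2 (g y) \<le> of_int k + 1"
        unfolding k_def by linarith+
      then have "2 powr of_int k < g y" "g y \<le> 2 powr (of_int k + 1)"
        using y(2) by (auto simp: less_log_iff log_le_iff)
      moreover from this have "y \<in> ?E k" using y by (simp add: ennreal_less_iff)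
      ultimately show ?thesis using V(2)[of k] unfolding J_def by blast
    qed
    have "(\<integral>\<^sup>+(k, v). ennreal (2 powr (of_int k + 1)) * wt v \<partial>count_space J)
        = (\<integral>\<^sup>+z. (case z of (k, v) \<Rightarrow> ennreal (2 powr (of_int k + 1)) * (wt v * indicator (V k) v)) \<partial>count_space UNIV)"
      by (auto simp: nn_integral_count_space_indicator J_def split: split_indicator intro!: nn_integral_cong)
    also have "\<dots> = (\<integral>\<^sup>+k. (\<integral>\<^sup>+v. ennreal (2 powr (of_int k + 1)) * (wt v * indicator (V k) v) \<partial>count_space UNIV) \<partial>count_space UNIV)"
      by (subst nn_integral_fst_count_space[symmetric]) simp
    also have "\<dots> = (\<integral>\<^sup>+k. ennreal (2 powr (of_int k + 1)) * (\<integral>\<^sup>+v. wt v \<partial>count_space (V k)) \<partial>count_space UNIV)"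
      by (simp add: nn_integral_cmult nn_integral_count_space_indicator[of "V _"])
    also have "\<dots> \<le> (\<integral>\<^sup>+k. 4 * (ennreal (2 powr (of_int k - 1)) * H (?E k)) + ennreal (e * (1/2) ^ Suc (to_nat k)) \<partial>count_space UNIV)"
    proof (rule nn_integral_mono)
      fix k :: int
      have "(2::real) powr (of_int k + 1) = 4 * 2 powr (of_int k - 1)"
        by (simp add: powr_diff powr_add)
      then have four: "ennreal (2 powr (of_int k + 1)) = 4 * ennreal (2 powr (of_int k - 1))"
        by (simp add: ennreal_mult)
      have "ennreal (2 powr (of_int k + 1)) * (\<integral>\<^sup>+v. wt v \<partial>count_space (V k))
          \<le> ennreal (2 powr (of_int k + 1)) * H (?E k) + ennreal (2 powr (of_int k + 1)) * ennreal (\<epsilon> k)"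
        using mult_left_mono[OF V(3)] by (simp add: distrib_left[symmetric])
      also have "ennreal (2 powr (of_int k + 1)) * ennreal (\<epsilon> k) = ennreal (e * (1/2) ^ Suc (to_nat k))"
        using e by (subst ennreal_mult[symmetric]) (auto simp: \<epsilon>_def)
      finally show "ennreal (2 powr (of_int k + 1)) * (\<integral>\<^sup>+v. wt v \<partial>count_space (V k))
          \<le> 4 * (ennreal (2 powr (of_int k - 1)) * H (?E k)) + ennreal (e * (1/2) ^ Suc (to_nat k))"
        by (simp add: four mult.assoc)
    qed
    also have "\<dots> = 4 * (\<integral>\<^sup>+k. ennreal (2 powr (of_int k - 1)) * H (?E k) \<partial>count_space UNIV)
        + (\<integral>\<^sup>+k. ennreal (e * (1/2) ^ Suc (to_nat (k::int))) \<partial>count_space UNIV)"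
      by (simp add: nn_integral_add nn_integral_cmult)
    also have "(\<integral>\<^sup>+k. ennreal (e * (1/2) ^ Suc (to_nat (k::int))) \<partial>count_space UNIV)
        = (\<integral>\<^sup>+n. ennreal (e * (1/2) ^ Suc n) \<partial>count_space (range (to_nat :: int \<Rightarrow> nat)))"
      by (rule nn_integral_bij_count_space) (auto simp: bij_betw_def)
    also have "\<dots> \<le> (\<integral>\<^sup>+n. ennreal (e * (1/2) ^ Suc n) \<partial>count_space UNIV)"
      by (rule nn_integral_count_space_mono_set) auto
    also have "\<dots> = ennreal (e * 1)"
      unfolding nn_integral_count_space_nat
      using e sums_mult[OF power_half_series, of e] by (intro suminf_ennreal_eq) auto
    finally show "(\<integral>\<^sup>+(k, v). ennreal (2 powr (of_int k + 1)) * wt v \<partial>count_space J)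
      \<le> 4 * choquet_integral H K (\<lambda>x. ennreal (g x)) + ennreal e"
      using dyadic_sum_content_le_choquet_integral[of "\<lambda>x. ennreal (g x)"]
      by (simp add: add_mono mult_left_mono order_trans)
  qed
qed

lemma choquet_maximal_inequality:
  assumes p: "\<beta> < p"
  shows "choquet_integral H K (\<lambda>x. ennreal_powr (maximal_operator m S K \<mu> f x) p)
    \<le> ennreal (maximal_const p \<alpha> s) * choquet_integral H K (\<lambda>x. ennreal (\<bar>f x\<bar> powr p))"
proof -
  define C where "C = min p 1 / (min p 1 - \<beta>)"
  have C: "0 < C" using p \<beta>_bounds by (auto simp: C_def min_def)
  let ?X = "choquet_integral H K (\<lambda>x. ennreal (\<bar>f x\<bar> powr p))"
  let ?Y = "choquet_integral H K (\<lambda>x. ennreal_powr (maximal_operator m S K \<mu> f x) p)"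
  have "?Y \<le> ennreal C * (4 * ?X)"
  proof (rule ennreal_le_epsilon)
    fix e :: real assume e: "0 < e"
    then have "0 < e / C" using C by simp
    from dyadic_cover[OF this, of "\<lambda>x. \<bar>f x\<bar> powr p"] obtain J :: "(int \<times> nat list) set" where
      J: "\<And>k v. (k, v) \<in> J \<Longrightarrow> v \<in> W"
        "\<And>y. y \<in> K \<Longrightarrow> 0 < \<bar>f y\<bar> powr p \<Longrightarrow> \<exists>k v. (k, v) \<in> J \<and> y \<in> Q v \<and> \<bar>f y\<bar> powr p \<le> 2 powr (of_int k + 1)"
        "(\<integral>\<^sup>+(k, v). ennreal (2 powr (of_int k + 1)) * wt v \<partial>count_space J) \<le> 4 * ?X + ennreal (e / C)"
      by metis
    have "?Y \<le> ennreal C * (\<integral>\<^sup>+z. ennreal (2 powr (of_int (fst z) + 1)) * wt (snd z) \<partial>count_space J)"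
      unfolding C_def
    proof (rule choquet_integral_maximal_operator_le[OF p])
      show "\<exists>j\<in>J. y \<in> Q (snd j) \<and> \<bar>f y\<bar> powr p \<le> 2 powr (of_int (fst j) + 1)" if "y \<in> K" "f y \<noteq> 0" for y
        using J(2)[of y] that by force
      show "snd z \<in> W" if "z \<in> J" for z
        using J(1)[of "fst z" "snd z"] that by simp
    qed auto
    also have "\<dots> \<le> ennreal C * (4 * ?X + ennreal (e / C))"
      using J(3) unfolding split_def by (rule mult_left_mono) simp
    also have "\<dots> = ennreal C * (4 * ?X) + ennreal e"
      using C e by (simp add: distrib_left ennreal_mult[symmetric])
    finally show "?Y \<le> ennreal C * (4 * ?X) + ennreal e" .
  qed
  also have "\<dots> = ennreal (4 * C) * ?X"
    using C by (simp add: ennreal_mult ac_simps)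
  also have "\<dots> \<le> ennreal (maximal_const p \<alpha> s) * ?X"
    using maximal_const_ge[OF \<alpha> p] by (intro mult_right_mono ennreal_leI) (auto simp: C_def)
  finally show ?thesis .
qed

end

theorem theorem1p1:
  fixes m :: nat
    and r :: "nat \<Rightarrow> real"
    and R S :: "nat \<Rightarrow> real ^ 'd \<Rightarrow> real ^ 'd"
    and b :: "nat \<Rightarrow> real ^ 'd"
    and K :: "(real ^ 'd) set"
    and q :: "nat \<Rightarrow> real"
    and \<mu> :: "(real ^ 'd) measure"
    and s \<alpha> p :: real
    and f :: "real ^ 'd \<Rightarrow> real"
  assumes "similarity_ifs m r R b S"
    and "self_similar_set m S K"
    and "probability_vector m q"
    and "self_similar_measure m S q \<mu>"
    and "hausdorff_dim K = ennreal s"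
    and "pcf m S K"
    and "0 < \<alpha>" and "\<alpha> < s"
    and "\<alpha> / s < p"
    and "f \<in> Lp_content m S K \<mu> s \<alpha> p"
  shows "choquet_integral (hausdorff_content m S K \<mu> s \<alpha>) K
           (\<lambda>x. ennreal_powr (maximal_operator m S K \<mu> f x) p)
         \<le> ennreal (maximal_const p \<alpha> s) *
           choquet_integral (hausdorff_content m S K \<mu> s \<alpha>) K (\<lambda>x. ennreal (\<bar>f x\<bar> powr p))"
proof -
  interpret pcf_content m r R S b K q \<mu> s \<alpha>
    using assms by unfold_locales auto
  show ?thesis using assms(9) by (rule choquet_maximal_inequality)
qed

end
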